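(* For $\epsilon>0$, let $\Omega_\epsilon\subset\mathbb{C}$ be the convex hull of $\{1,-1,\epsilon i,-\epsilon i\}$. Then the analytic configuration constant satisfies $$a(\Omega_\epsilon)\ge 1-\frac{4}{\pi}\epsilon.$$
   Context: The analytic configuration constant $a(\Omega)$ of a compact convex set $\Omega\subset\mathbb{C}$ with non-empty interior is defined as follows. The boundary $\partial\Omega$ is a rectifiable simple closed curve, oriented counter-clockwise; $s$ denotes arclength measure on $\partial\Omega$. At every $\zeta\in\partial\Omega$ the one-sided tangent angles $\alpha_-(\zeta)\le\alpha_+(\zeta)$ (incoming and outgoing, with branches chosen so that $0\le\alpha_+(\zeta)-\alpha_-(\zeta)<\pi$) exist; $\zeta$ is called a corner if $\alpha_-(\zeta)<\alpha_+(\zeta)$, and there are at most countably many corners. Put $\theta_\zeta:=\pi-\alpha_+(\zeta)+\alpha_-(\zeta)\in(0,\pi]$ (the interior angle at $\zeta$; it equals $\pi$ if $\zeta$ is not a corner). At a non-corner $\sigma$ let $T(\sigma)$ be the unit tangent (in the positive direction) and $N(\sigma)=-iT(\sigma)$ the outward unit normal. For $\zeta\in\partial\Omega$ let $\mu_\zeta$ be the Borel probability measure on $\partial\Omega$ given by $d\mu_\zeta=(1-\theta_\zeta/\pi)\,d\delta_\zeta+\rho_\zeta\,ds$, where $\delta_\zeta$ is the unit point mass at $\zeta$ and $\rho_\zeta(\sigma)=\frac1\pi\operatorname{Re}\Big(\frac{N(\sigma)}{\sigma-\zeta}\Big)$ for non-corners $\sigma\ne\zeta$. Let $C(\partial\Omega)$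 be the space of complex-valued continuous functions on $\partial\Omega$. The Neumann–Poincaré operator $K_\Omega:C(\partial\Omega)\to C(\partial\Omega)$ is $K_\Omega f(\zeta):=\int_{\partial\Omega}f\,d\mu_\zeta$, $\zeta\in\partial\Omega$; it fixes the constant function $\mathbf{1}$, so it acts on $C(\partial\Omega)/\mathbb{C}\mathbf{1}$, which has the quotient norm $\|g+\mathbb{C}\mathbf{1}\|_{\partial\Omega}=\min_{\lambda\in\mathbb{C}}\max_{\zeta\in\partial\Omega}|g(\zeta)-\lambda|$. Let $\mathcal{A}(\Omega)$ be the space of functions continuous on $\Omega$ and analytic in the interior of $\Omega$, regarded as a subspace of $C(\partial\Omega)$ by restriction to $\partial\Omega$. The analytic configuration constant is the operator norm $a(\Omega):=\|K_\Omega:\mathcal{A}(\Omega)/\mathbb{C}\mathbf{1}\to C(\partial\Omega)/\mathbb{C}\mathbf{1}\|$. *)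

theory Defs
  imports "HOL-Complex_Analysis.Complex_Analysis"
begin

definition path_length :: "(real \<Rightarrow> complex) \<Rightarrow> real \<Rightarrow> real \<Rightarrow> ennreal" where
  "path_length \<gamma> a b =
     (SUP (n, p) \<in> {(n :: nat, p :: nat \<Rightarrow> real).
                      p 0 = a \<and> p n = b \<and> (\<forall>i<n. p i \<le> p (Suc i))}.
        ennreal (\<Sum>i<n. dist (\<gamma> (p i)) (\<gamma> (p (Suc i)))))"

text \<open>
  A counter-clockwise arclength parametrization of the boundary of \<open>\<Omega>\<close>, extended to an
  \<open>L\<close>-periodic function on the real line, where \<open>L\<close> is the length of the boundary.
\<close>

definition is_boundary_param :: "complex set \<Rightarrow> real \<Rightarrow> (real \<Rightarrow> complex) \<Rightarrow> bool" where
  "is_boundary_param \<Omega> L \<gamma> \<longleftrightarrow>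
     0 < L \<and> continuous_on UNIV \<gamma> \<and> (\<forall>t. \<gamma> (t + L) = \<gamma> t) \<and>
     inj_on \<gamma> {0..<L} \<and> \<gamma> ` {0..<L} = frontier \<Omega> \<and>
     (\<forall>a b. a \<le> b \<longrightarrow> path_length \<gamma> a b = ennreal (b - a)) \<and>
     (\<forall>z\<in>interior \<Omega>. winding_number (\<lambda>t. \<gamma> (L * t)) z = 1)"

text \<open>
  For a compact convex set with non-empty interior such a parametrization exists; \<open>L\<close> is
  determined by \<open>\<Omega>\<close>, and \<open>\<gamma>\<close> is unique up to a translation \<open>t \<mapsto> t + c\<close> of the parameter.
  None of the notions derived from the chosen one below depends on this translation.
\<close>

definition boundary_param :: "complex set \<Rightarrow> real \<times> (real \<Rightarrow> complex)" where
  "boundary_param \<Omega> = (SOME (L, \<gamma>). is_boundary_param \<Omega> L \<gamma>)"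

definition perimeter :: "complex set \<Rightarrow> real" where
  "perimeter \<Omega> = fst (boundary_param \<Omega>)"

definition boundary_curve :: "complex set \<Rightarrow> real \<Rightarrow> complex" where
  "boundary_curve \<Omega> = snd (boundary_param \<Omega>)"

text \<open>
  All measures live on the Borel sets of the boundary itself rather than of the plane, so that
  a function which is continuous on the boundary and arbitrary elsewhere is measurable.
\<close>

definition arclength_measure :: "complex set \<Rightarrow> complex measure" where
  "arclength_measure \<Omega> =
     distr (restrict_space lborel {0..<perimeter \<Omega>}) (restrict_space borel (frontier \<Omega>))
       (boundary_curve \<Omega>)"

text \<open>
  \<open>\<alpha>\<close> and \<open>\<beta>\<close> are the incoming and the outgoing tangent angle at \<open>\<zeta>\<close>. As the curve is
  parametrized by arclength, its one-sided derivatives are the one-sided unit tangents.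
  The angles are determined by \<open>\<zeta>\<close> up to a common multiple of \<open>2\<pi>\<close>.
\<close>

definition tangent_angles :: "complex set \<Rightarrow> complex \<Rightarrow> real \<Rightarrow> real \<Rightarrow> bool" where
  "tangent_angles \<Omega> \<zeta> \<alpha> \<beta> \<longleftrightarrow>
     (\<exists>t. boundary_curve \<Omega> t = \<zeta> \<and>
          (boundary_curve \<Omega> has_vector_derivative cis \<alpha>) (at_left t) \<and>
          (boundary_curve \<Omega> has_vector_derivative cis \<beta>) (at_right t)) \<and>
     0 \<le> \<beta> - \<alpha> \<and> \<beta> - \<alpha> < pi"

definition is_corner :: "complex set \<Rightarrow> complex \<Rightarrow> bool" where
  "is_corner \<Omega> \<zeta> \<longleftrightarrow> (\<exists>\<alpha> \<beta>. tangent_angles \<Omega> \<zeta> \<alpha> \<beta> \<and> \<alpha> < \<beta>)"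

definition interior_angle :: "complex set \<Rightarrow> complex \<Rightarrow> real" where
  "interior_angle \<Omega> \<zeta> = (THE \<theta>. \<exists>\<alpha> \<beta>. tangent_angles \<Omega> \<zeta> \<alpha> \<beta> \<and> \<theta> = pi - \<beta> + \<alpha>)"

text \<open>The next two are meaningful at non-corners only.\<close>

definition unit_tangent :: "complex set \<Rightarrow> complex \<Rightarrow> complex" where
  "unit_tangent \<Omega> \<sigma> = (THE u. \<exists>\<alpha>. tangent_angles \<Omega> \<sigma> \<alpha> \<alpha> \<and> u = cis \<alpha>)"

definition outward_normal :: "complex set \<Rightarrow> complex \<Rightarrow> complex" where
  "outward_normal \<Omega> \<sigma> = - \<i> * unit_tangent \<Omega> \<sigma>"

text \<open>
  The value 0 at \<open>\<zeta>\<close> and at the corners is immaterial: these points form a countable set,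
  which is null for arclength.
\<close>

definition np_density :: "complex set \<Rightarrow> complex \<Rightarrow> complex \<Rightarrow> real" where
  "np_density \<Omega> \<zeta> \<sigma> =
     (if \<sigma> = \<zeta> \<or> is_corner \<Omega> \<sigma> then 0
      else 1 / pi * Re (outward_normal \<Omega> \<sigma> / (\<sigma> - \<zeta>)))"

definition np_measure :: "complex set \<Rightarrow> complex \<Rightarrow> complex measure" where
  "np_measure \<Omega> \<zeta> =
     measure_of (frontier \<Omega>) (sets (restrict_space borel (frontier \<Omega>)))
       (\<lambda>A. ennreal (1 - interior_angle \<Omega> \<zeta> / pi) * indicator A \<zeta> +
            emeasure (density (arclength_measure \<Omega>) (\<lambda>\<sigma>. ennreal (np_density \<Omega> \<zeta> \<sigma>))) A)"

definition neumann_poincare :: "complex set \<Rightarrow> (complex \<Rightarrow> complex) \<Rightarrow> complex \<Rightarrow> complex" where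
  "neumann_poincare \<Omega> f \<zeta> = (LINT \<sigma>|np_measure \<Omega> \<zeta>. f \<sigma>)"

definition quotient_norm :: "complex set \<Rightarrow> (complex \<Rightarrow> complex) \<Rightarrow> real" where
  "quotient_norm X g = (INF c. SUP \<zeta>\<in>X. cmod (g \<zeta> - c))"

definition analytic_algebra :: "complex set \<Rightarrow> (complex \<Rightarrow> complex) set" where
  "analytic_algebra \<Omega> = {f. continuous_on \<Omega> f \<and> f holomorphic_on interior \<Omega>}"

definition analytic_config_const :: "complex set \<Rightarrow> real" where
  "analytic_config_const \<Omega> =
     (SUP f \<in> {f \<in> analytic_algebra \<Omega>. quotient_norm (frontier \<Omega>) f \<le> 1}.
        quotient_norm (frontier \<Omega>) (neumann_poincare \<Omega> f))"

end

theory Submission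
  imports Defs
begin

text \<open>
  Take \<open>f(z) = z\<close>, whose quotient norm is at most 1 if \<open>\<epsilon> \<le> 1\<close>. At a tip \<open>\<plusminus>1\<close> of the rhombus the
  interior angle is \<open>\<theta> = 2 arctan \<epsilon> \<le> 2\<epsilon>\<close>, so the probability measure \<open>\<mu>\<^sub>1\<close> has mass at least
  \<open>1 - \<theta> / \<pi>\<close> at the point 1, and \<open>Re (K f 1) \<ge> (1 - \<theta> / \<pi>) - \<theta> / \<pi> \<ge> 1 - 4\<epsilon> / \<pi>\<close> as \<open>Re z \<ge> -1\<close> on
  the rhombus. Symmetrically for \<open>-1\<close>, and two values at distance \<open>2r\<close> force quotient norm at
  least \<open>r\<close>. If \<open>\<epsilon> > 1\<close> then \<open>f = 0\<close> suffices.

  That the total mass of \<open>\<mu>\<^sub>\<zeta>\<close> is 1 makes the supremum finite, and it holds because \<open>\<pi>\<close> times the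
  density of \<open>\<mu>\<^sub>\<zeta>\<close> is the derivative of the argument of \<open>\<gamma>(t) - \<zeta>\<close>, which increases by the interior
  angle while \<open>\<gamma>\<close> runs once around the boundary. Since the boundary curve is an arbitrary
  choice, one needs its uniqueness up to a shift: about an interior point, a boundary parametrization
  has a strictly increasing angle function, so two of them differ by a monotone change of
  parameter, and equal path lengths make this change a translation.
\<close>

section \<open>Uniqueness of the boundary parametrization\<close>

text \<open>Equal exponentials force the difference into the integer multiples of 2 pi i. Distinct
  such values are at least 2 pi apart, and a continuous function with so discrete a range is
  constant on a connected set.\<close>

lemma exp_lifts_differ_by_constant:
  fixes g h :: "real \<Rightarrow> complex"
  assumes "connected S" "continuous_on S g" "continuous_on S h"
    and eq: "\<And>x. x \<in> S \<Longrightarrow> exp (g x) = exp (h x)"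
  obtains c where "\<And>x. x \<in> S \<Longrightarrow> g x - h x = c"
proof -
  have "(\<lambda>x. g x - h x) constant_on S"
  proof (rule continuous_discrete_range_constant[OF assms(1)])
    show "continuous_on S (\<lambda>x. g x - h x)"
      by (intro continuous_intros assms)
    fix x assume x: "x \<in> S"
    have "2 * pi \<le> cmod ((g y - h y) - (g x - h x))"
      if y: "y \<in> S" "g y - h y \<noteq> g x - h x" for y
    proof -
      have "exp ((g y - h y) - (g x - h x)) = 1"
        using eq x y by (simp add: exp_diff)
      then obtain n :: int where n: "Re ((g y - h y) - (g x - h x)) = 0"
          "Im ((g y - h y) - (g x - h x)) = of_int (2 * n) * pi"
        unfolding exp_eq_1 by blast
      have "n \<noteq> 0"
        using y(2) n by (auto simp: complex_eq_iff)
      then have "1 \<le> \<bar>real_of_int n\<bar>" by linarith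
      then have "2 * pi \<le> \<bar>of_int (2 * n) * pi\<bar>"
        by (simp add: abs_mult)
      also have "\<dots> \<le> cmod ((g y - h y) - (g x - h x))"
        using abs_Im_le_cmod n(2) by metis
      finally show ?thesis .
    qed
    then show "\<exists>e>0. \<forall>y. y \<in> S \<and> g y - h y \<noteq> g x - h x \<longrightarrow> e \<le> cmod (g y - h y - (g x - h x))"
      by (intro exI[of _ "2 * pi"]) auto
  qed
  then show ?thesis
    using that unfolding constant_on_def by blast
qed

lemma periodic_int:
  fixes f :: "real \<Rightarrow> 'a"
  assumes "\<And>t. f (t + L) = f t"
  shows "f (t + of_int k * L) = f t"
proof -
  have nat: "f (t + of_nat n * L) = f t" for n t
  proof (induction n)
    case (Suc n)
    then show ?case using assms[of "t + of_nat n * L"] by (simp add: algebra_simps)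
  qed simp
  show ?thesis
  proof (cases k)
    case (nonneg n)
    then show ?thesis using nat by simp
  next
    case (neg n)
    then have "(of_int k + of_nat (Suc n)) * L = 0" by simp
    then have "t + of_int k * L + of_nat (Suc n) * L = t" by (simp add: distrib_right)
    then show ?thesis using nat[of "t + of_int k * L" "Suc n"] by metis
  qed
qed

lemma is_boundary_paramD:
  assumes "is_boundary_param \<Omega> L \<gamma>"
  shows "0 < L" "continuous_on UNIV \<gamma>" "\<gamma> (t + L) = \<gamma> t" "inj_on \<gamma> {0..<L}"
    "\<gamma> ` {0..<L} = frontier \<Omega>" "a \<le> b \<Longrightarrow> path_length \<gamma> a b = ennreal (b - a)"
    "z \<in> interior \<Omega> \<Longrightarrow> winding_number (\<lambda>t. \<gamma> (L * t)) z = 1"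
  using assms unfolding is_boundary_param_def by auto

lemma floor_divide_bounds:
  assumes "0 < (L :: real)"
  shows "of_int \<lfloor>t / L\<rfloor> * L \<le> t" "t < (of_int \<lfloor>t / L\<rfloor> + 1) * L"
  using assms floor_correct[of "t / L"]
  by (simp_all only: pos_le_divide_eq[symmetric] pos_divide_less_eq[symmetric] of_int_add of_int_1)

lemma reduce_mod_period:
  assumes "0 < (L :: real)"
  shows "t + of_int (- \<lfloor>t / L\<rfloor>) * L \<in> {0..<L}"
  using floor_divide_bounds[OF assms, of t] by (simp add: algebra_simps)

lemma boundary_param_in_frontier:
  assumes "is_boundary_param \<Omega> L \<gamma>"
  shows "\<gamma> t \<in> frontier \<Omega>"
proof -
  note D = is_boundary_paramD[OF assms]
  have "\<gamma> (t + of_int (- \<lfloor>t / L\<rfloor>) * L) = \<gamma> t"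
    by (rule periodic_int) (rule D)
  then show ?thesis
    using reduce_mod_period[OF D(1), of t] D(5) by (metis imageI)
qed

lemma boundary_param_eqD:
  assumes "is_boundary_param \<Omega> L \<gamma>" and "\<gamma> s = \<gamma> t"
  obtains k :: int where "s = t + of_int k * L"
proof -
  note D = is_boundary_paramD[OF assms(1)]
  have "\<gamma> (s + of_int (- \<lfloor>s / L\<rfloor>) * L) = \<gamma> (t + of_int (- \<lfloor>t / L\<rfloor>) * L)"
    using assms(2) periodic_int[of \<gamma>, OF D(3)] by metis
  then have "s + of_int (- \<lfloor>s / L\<rfloor>) * L = t + of_int (- \<lfloor>t / L\<rfloor>) * L"
    using D(4) reduce_mod_period[OF D(1)] by (metis inj_onD)
  then have "s = t + of_int (\<lfloor>s / L\<rfloor> - \<lfloor>t / L\<rfloor>) * L"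
    by (simp add: algebra_simps)
  then show ?thesis using that by blast
qed

text \<open>The open segment from an interior point to a point of the closure lies in the interior,
  so the nearer of two frontier points on a ray from 0 would be interior.\<close>

lemma frontier_ray_unique:
  fixes \<Omega> :: "complex set"
  assumes "convex \<Omega>" "closed \<Omega>" "0 \<in> interior \<Omega>"
    and "of_real r * u \<in> frontier \<Omega>" "of_real s * u \<in> frontier \<Omega>" "0 < r" "0 < s"
  shows "r = s"
proof -
  have False if "of_real r * u \<in> frontier \<Omega>" "of_real s * u \<in> frontier \<Omega>" "0 < r" "r < s" for r s
  proof -
    have "s *\<^sub>R u \<in> closure \<Omega>" using that by (simp add: frontier_def scaleR_conv_of_real)
    then have sub: "open_segment 0 (s *\<^sub>R u) \<subseteq> interior \<Omega>"
      using assms by (intro in_interior_closure_convex_segment) auto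
    have "u \<noteq> 0" using that assms by (auto simp: frontier_def)
    then have "r *\<^sub>R u \<in> open_segment 0 (s *\<^sub>R u)"
      using that by (auto simp: in_segment intro!: exI[of _ "r / s"])
    then show False using sub that by (auto simp: frontier_def scaleR_conv_of_real)
  qed
  from this[of r s] this[of s r] assms show ?thesis by force
qed

lemma boundary_param_nonzero:
  assumes "is_boundary_param \<Omega> L \<gamma>" "0 \<in> interior \<Omega>"
  shows "\<gamma> t \<noteq> 0"
  using boundary_param_in_frontier[OF assms(1), of t] assms(2) by (auto simp: frontier_def)

text \<open>The angle is the imaginary part of a global logarithm of \<gamma>, and winding number 1
  makes it grow by 2 pi per period. A ray from 0 meets the frontier only once, so the angle is
  injective, hence strictly monotone; its growth over a period settles the direction.\<close>

lemma boundary_param_angle: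
  assumes par: "is_boundary_param \<Omega> L \<gamma>"
    and \<Omega>: "convex \<Omega>" "closed \<Omega>" "0 \<in> interior \<Omega>"
  obtains \<phi> where "strict_mono \<phi>" "surj \<phi>" "\<And>t. \<gamma> t = of_real (cmod (\<gamma> t)) * cis (\<phi> t)"
proof -
  note D = is_boundary_paramD[OF par]
  have nz: "\<gamma> t \<noteq> 0" for t
    by (rule boundary_param_nonzero[OF par \<Omega>(3)])
  obtain g where g: "continuous_on UNIV g" "\<And>t. \<gamma> t = exp (g t)"
    using continuous_logarithm_on_contractible[OF D(2) convex_imp_contractible[OF convex_UNIV]] nz
    by (metis UNIV_I)
  define p where "p = (\<lambda>t. \<gamma> (L * t))"
  have "path p"
    unfolding path_def p_def
    by (intro continuous_on_compose2[OF D(2)] continuous_intros) auto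
  moreover have "0 \<notin> path_image p"
    using nz by (auto simp: path_image_def p_def)
  ultimately have "\<exists>q. path q \<and>
      pathfinish q - pathstart q = 2 * of_real pi * \<i> * winding_number p 0 \<and>
      (\<forall>t\<in>{0..1}. p t = 0 + exp (q t))"
    by (blast elim: winding_number_as_continuous_log)
  then obtain q where q: "path q"
      "pathfinish q - pathstart q = 2 * of_real pi * \<i> * winding_number p 0"
      "\<And>t. t \<in> {0..1} \<Longrightarrow> p t = 0 + exp (q t)"
    by blast
  have "continuous_on {0..1} (\<lambda>t. g (L * t))"
    by (intro continuous_on_compose2[OF g(1)] continuous_intros) auto
  \<comment> \<open>The logarithm \<open>q\<close> that expresses the winding number exists on [0,1]
    only; comparing it with \<open>g\<close> transfers its total increment to the global
    lift.\<close>
  then obtain c where c: "\<And>t. t \<in> {0..1} \<Longrightarrow> q t - g (L * t) = c"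
    using q(1,3) g(2)
    by (auto simp: path_def p_def
        intro: exp_lifts_differ_by_constant[of "{0..1}" q "\<lambda>t. g (L * t)"])
  have "g L - g 0 = 2 * of_real pi * \<i>"
    using c[of 0] c[of 1] q(2) D(7)[OF \<Omega>(3)]
    by (simp add: pathfinish_def pathstart_def p_def algebra_simps)
  moreover have "continuous_on UNIV (\<lambda>t. g (t + L))"
    by (intro continuous_on_compose2[OF g(1)] continuous_intros) auto
  \<comment> \<open>The functions g(t + L) and g(t) are logarithms of the same periodic curve, so
    the increment over a period does not depend on t and can be read off at t = 0.\<close>
  then obtain d where d: "\<And>t. g (t + L) - g t = d"
    using exp_lifts_differ_by_constant[of UNIV "\<lambda>t. g (t + L)" g] g D(3)
    by (metis UNIV_I connected_UNIV)
  ultimately have per: "g (t + L) = g t + 2 * of_real pi * \<i>" for t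
    by (metis add.commute add.left_neutral diff_eq_eq)
  define \<phi> where "\<phi> = (\<lambda>t. Im (g t))"
  have polar: "\<gamma> t = of_real (cmod (\<gamma> t)) * cis (\<phi> t)" for t
    unfolding g(2) \<phi>_def by (simp add: exp_eq_polar norm_mult)
  have perk: "\<phi> (t + of_int k * L) = \<phi> t + of_int k * (2 * pi)" for t k
  proof -
    \<comment> \<open>Subtracting the linear growth leaves an L-periodic function, to which
      \<open>periodic_int\<close> applies.\<close>
    have "\<phi> (t + of_int k * L) - 2 * pi / L * (t + of_int k * L) = \<phi> t - 2 * pi / L * t"
      by (rule periodic_int) (use per D(1) in \<open>simp add: \<phi>_def field_simps\<close>)
    moreover have "2 * pi / L * (t + of_int k * L) = 2 * pi / L * t + of_int k * (2 * pi)"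
      using D(1) by (simp add: field_simps)
    ultimately show ?thesis by linarith
  qed
  have cont: "continuous_on UNIV \<phi>"
    unfolding \<phi>_def by (intro continuous_intros g)
  have "inj \<phi>"
  proof (rule injI)
    fix s t assume eq: "\<phi> s = \<phi> t"
    have "cmod (\<gamma> s) = cmod (\<gamma> t)"
      using frontier_ray_unique[OF \<Omega>, of "cmod (\<gamma> s)" "cis (\<phi> t)" "cmod (\<gamma> t)"]
        boundary_param_in_frontier[OF par] polar eq nz by (metis zero_less_norm_iff)
    then have "\<gamma> s = \<gamma> t" using polar eq by metis
    then obtain k where "s = t + of_int k * L" using boundary_param_eqD[OF par] by blast
    with perk[of t k] eq show "s = t" by simp
  qed
  then have "strict_mono \<phi> \<or> strict_antimono_on UNIV \<phi>"
    using injective_eq_monotone_map[OF _ cont] by auto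
  moreover have "\<phi> 0 < \<phi> L" using perk[of 0 1] by simp
  ultimately have sm: "strict_mono \<phi>"
    using D(1) by (metis UNIV_I monotone_onD order_less_asym)
  have "surj \<phi>"
  proof -
    have "y \<in> range \<phi>" for y
    proof -
      \<comment> \<open>This k puts y between \<phi>(k L) and \<phi>((k + 1) L), ready for the
        intermediate value theorem.\<close>
      define k where "k = \<lfloor>(y - \<phi> 0) / (2 * pi)\<rfloor>"
      have k: "of_int k * (2 * pi) \<le> y - \<phi> 0" "y - \<phi> 0 \<le> of_int (k + 1) * (2 * pi)"
        using floor_divide_bounds[of "2 * pi" "y - \<phi> 0"] by (auto simp: k_def)
      have "\<exists>x\<ge>of_int k * L. x \<le> of_int (k + 1) * L \<and> \<phi> x = y"
        using perk[of 0 k] perk[of 0 "k + 1"] k D(1)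
        by (intro IVT') (auto intro: continuous_on_subset[OF cont])
      then show ?thesis by auto
    qed
    then show ?thesis by auto
  qed
  with sm polar show ?thesis using that by blast
qed

section \<open>Equal path lengths turn a change of parameter into a translation\<close>

text \<open>A monotone h carries partitions of [a, b] to partitions of [h a, h b] with the same
  chord sum. Applied to a bijection and to its inverse, the inequality becomes an equality.\<close>

lemma path_length_reparam_le:
  assumes "mono h"
  shows "path_length (\<gamma> \<circ> h) a b \<le> path_length \<gamma> (h a) (h b)"
  unfolding path_length_def
proof (rule SUP_mono, safe)
  fix n :: nat and p :: "nat \<Rightarrow> real"
  assume "a = p 0" "b = p n" and p: "\<forall>i<n. p i \<le> p (Suc i)"
  then show "\<exists>m\<in>{(m, q). q 0 = h (p 0) \<and> q m = h (p n) \<and> (\<forall>i<m. q i \<le> q (Suc i))}.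
      ennreal (\<Sum>i<n. dist ((\<gamma> \<circ> h) (p i)) ((\<gamma> \<circ> h) (p (Suc i))))
      \<le> (case m of (m, q) \<Rightarrow> ennreal (\<Sum>i<m. dist (\<gamma> (q i)) (\<gamma> (q (Suc i)))))"
    using assms by (intro bexI[of _ "(n, h \<circ> p)"]) (auto dest: monoD)
qed

lemma boundary_param_unique:
  assumes par1: "is_boundary_param \<Omega> L1 \<gamma>1" and par2: "is_boundary_param \<Omega> L2 \<gamma>2"
    and \<Omega>: "convex \<Omega>" "closed \<Omega>" "0 \<in> interior \<Omega>"
  obtains c where "L1 = L2" "\<And>t. \<gamma>1 t = \<gamma>2 (t + c)"
proof -
  note D1 = is_boundary_paramD[OF par1] and D2 = is_boundary_paramD[OF par2]
  obtain \<phi>1 where \<phi>1: "strict_mono \<phi>1" "surj \<phi>1" "\<And>t. \<gamma>1 t = of_real (cmod (\<gamma>1 t)) * cis (\<phi>1 t)"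
    using boundary_param_angle[OF par1 \<Omega>] by blast
  obtain \<phi>2 where \<phi>2: "strict_mono \<phi>2" "surj \<phi>2" "\<And>t. \<gamma>2 t = of_real (cmod (\<gamma>2 t)) * cis (\<phi>2 t)"
    using boundary_param_angle[OF par2 \<Omega>] by blast
  have inv_mono: "mono (inv \<phi>)" if "strict_mono \<phi>" "surj \<phi>" for \<phi> :: "real \<Rightarrow> real"
  proof (rule monoI)
    fix x y :: real assume "x \<le> y"
    then have "\<phi> (inv \<phi> x) \<le> \<phi> (inv \<phi> y)" using that by (simp add: surj_f_inv_f)
    then show "inv \<phi> x \<le> inv \<phi> y" using that(1) by (simp add: strict_mono_less_eq)
  qed
  \<comment> \<open>\<open>h\<close> matches parameters at which the two curves have the same angle
    about 0; \<open>frontier_ray_unique\<close> then makes the points themselves agree.\<close>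
  define h where "h = inv \<phi>2 \<circ> \<phi>1"
  define h' where "h' = inv \<phi>1 \<circ> \<phi>2"
  have mono: "mono h" "mono h'"
    unfolding h_def h'_def using inv_mono \<phi>1 \<phi>2
    by (auto simp: strict_mono_mono intro!: monotone_on_o[of UNIV _ _ _ UNIV])
  have inv: "h' (h t) = t" "h (h' t) = t" for t
    using \<phi>1 \<phi>2 by (simp_all add: h_def h'_def surj_f_inv_f inv_f_f strict_mono_imp_inj_on)
  have eq: "\<gamma>1 t = \<gamma>2 (h t)" for t
  proof -
    have "\<phi>2 (h t) = \<phi>1 t" using \<phi>2 by (simp add: h_def surj_f_inv_f)
    moreover from this have "cmod (\<gamma>1 t) = cmod (\<gamma>2 (h t))"
      using frontier_ray_unique[OF \<Omega>, of "cmod (\<gamma>1 t)" "cis (\<phi>1 t)" "cmod (\<gamma>2 (h t))"]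
        boundary_param_in_frontier[OF par1, of t] boundary_param_in_frontier[OF par2, of "h t"]
        \<phi>1(3)[of t] \<phi>2(3)[of "h t"] boundary_param_nonzero[OF par1 \<Omega>(3), of t]
        boundary_param_nonzero[OF par2 \<Omega>(3), of "h t"] by simp
    ultimately show ?thesis using \<phi>1(3)[of t] \<phi>2(3)[of "h t"] by metis
  qed
  have comp: "\<gamma>1 = \<gamma>2 \<circ> h" "\<gamma>2 = \<gamma>1 \<circ> h'" using eq inv by auto
  have speed: "h b - h a = b - a" if "a \<le> b" for a b
  proof -
    have le: "h a \<le> h b" using mono that by (auto dest: monoD)
    have "path_length \<gamma>1 a b = path_length \<gamma>2 (h a) (h b)"
      using path_length_reparam_le[OF mono(1), of \<gamma>2 a b, folded comp(1)]
        path_length_reparam_le[OF mono(2), of \<gamma>1 "h a" "h b", folded comp(2)]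
      unfolding inv by (rule order_antisym)
    then show ?thesis using D1(6)[OF that] D2(6)[OF le] that le by simp
  qed
  have h: "h t = t + h 0" for t
    using speed[of 0 t] speed[of t 0] by (cases "0 \<le> t") auto
  have shift: "\<gamma>1 t = \<gamma>2 (t + h 0)" for t
    using eq h by metis
  have per: "\<gamma>2 (t + L1) = \<gamma>2 t" for t
    using shift[of "t - h 0 + L1"] shift[of "t - h 0"] D1(3)[of "t - h 0"] by simp
  have per': "\<gamma>1 (t + L2) = \<gamma>1 t" for t
    using shift[of "t + L2"] shift[of t] D2(3)[of "t + h 0"] by (simp add: algebra_simps)
  \<comment> \<open>By the shift, each period is a period of both curves. The smaller one would then
    contradict injectivity on the half-open interval given by the larger one.\<close>
  have "L1 = L2"
  proof (rule linorder_cases[of L1 L2])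
    assume "L1 < L2"
    then show ?thesis
      using inj_onD[OF D2(4), of 0 L1] per[of 0] D1(1) by auto
  next
    assume "L2 < L1"
    then show ?thesis
      using inj_onD[OF D1(4), of 0 L2] per'[of 0] D2(1) by auto
  qed
  then show ?thesis using that shift by blast
qed

section \<open>The boundary of the rhombus\<close>

lemma unit_speed_partition:
  fixes \<gamma> :: "real \<Rightarrow> complex"
  assumes "0 < d" "a \<le> b"
    and unit: "\<And>(n :: int) s t. \<lbrakk>d * of_int n \<le> s; s \<le> t; t \<le> d * of_int (n + 1)\<rbrakk> \<Longrightarrow> dist (\<gamma> s) (\<gamma> t) = t - s"
  obtains m q where "q 0 = a" "q m = b" "\<And>i. q i \<le> q (Suc i)"
    "\<And>i. dist (\<gamma> (q i)) (\<gamma> (q (Suc i))) = q (Suc i) - q i"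
proof -
  define N where "N = \<lfloor>a / d\<rfloor>"
  \<comment> \<open>The grid starts at the last grid point not beyond a, up to one cell early; the
    extra 1 makes up for this, so that the grid reaches b.\<close>
  define M where "M = nat \<lceil>(b - a) / d + 1\<rceil>"
  define x where "x = (\<lambda>i. d * of_int (N + int i))"
  \<comment> \<open>Grid points are clamped to [a, b]. Cells outside collapse to trivial steps, and
    every nontrivial step stays inside a single cell.\<close>
  define q where "q = (\<lambda>i. max a (min b (x i)))"
  have x_mono: "x i \<le> x (Suc i)" for i
    using assms(1) by (simp add: x_def algebra_simps)
  have le: "q i \<le> q (Suc i)" for i
    using x_mono[of i] by (auto simp: q_def)
  have N: "of_int N * d \<le> a" "a < (of_int N + 1) * d"
    using floor_divide_bounds[OF assms(1), of a] by (simp_all add: N_def)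
  have "(b - a) / d + 1 \<le> of_nat M"
    unfolding M_def by linarith
  then have "(b - a) + d \<le> of_nat M * d"
    using assms(1) by (simp add: field_simps)
  then have "b \<le> x M"
    using N by (simp add: x_def algebra_simps)
  then have qM: "q M = b" using assms(2) by (simp add: q_def)
  have "x 0 \<le> a" using N by (simp add: x_def algebra_simps)
  then have q0: "q 0 = a" using assms(2) by (simp add: q_def)
  have "dist (\<gamma> (q i)) (\<gamma> (q (Suc i))) = q (Suc i) - q i" for i
  proof (cases "q i = q (Suc i)")
    case False
    then have "x i \<le> q i" "q (Suc i) \<le> x (Suc i)"
      using x_mono[of i] assms(2) by (auto simp: q_def max_def min_def split: if_splits)
    then show ?thesis
      using unit[of "N + int i" "q i" "q (Suc i)"] le[of i] by (simp add: x_def algebra_simps)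
  qed simp
  with q0 qM le that show ?thesis by blast
qed

text \<open>The clamped grid has chord sum exactly b - a, which gives the lower bound. By the
  triangle inequality it also shows that the curve is 1-Lipschitz, so every chord sum is at most a
  telescoping sum.\<close>

lemma path_length_unit_speed:
  fixes \<gamma> :: "real \<Rightarrow> complex"
  assumes "0 < d"
    and unit: "\<And>(n :: int) s t. \<lbrakk>d * of_int n \<le> s; s \<le> t; t \<le> d * of_int (n + 1)\<rbrakk> \<Longrightarrow> dist (\<gamma> s) (\<gamma> t) = t - s"
    and "a \<le> b"
  shows "path_length \<gamma> a b = ennreal (b - a)"
proof (rule antisym)
  have lip: "dist (\<gamma> s) (\<gamma> t) \<le> t - s" if st: "s \<le> t" for s t
  proof -
    obtain m q where q: "q 0 = s" "q m = t"
        "\<And>i. dist (\<gamma> (q i)) (\<gamma> (q (Suc i))) = q (Suc i) - q i"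
      using unit_speed_partition[OF assms(1) st, of \<gamma>] unit by metis
    have "dist (\<gamma> (q 0)) (\<gamma> (q k)) \<le> q k - q 0" for k
    proof (induction k)
      case (Suc k)
      then show ?case
        using dist_triangle[of "\<gamma> (q 0)" "\<gamma> (q (Suc k))" "\<gamma> (q k)"] q(3)[of k] by linarith
    qed simp
    then show ?thesis using q by metis
  qed
  show "path_length \<gamma> a b \<le> ennreal (b - a)"
    unfolding path_length_def
  proof (rule SUP_least, safe)
    fix n :: nat and p :: "nat \<Rightarrow> real"
    assume p: "\<forall>i<n. p i \<le> p (Suc i)" "a = p 0" "b = p n"
    have "(\<Sum>i<n. dist (\<gamma> (p i)) (\<gamma> (p (Suc i)))) \<le> (\<Sum>i<n. p (Suc i) - p i)"
      using p lip by (intro sum_mono) auto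
    also have "\<dots> = p n - p 0" by (rule sum_lessThan_telescope)
    finally show "ennreal (\<Sum>i<n. dist (\<gamma> (p i)) (\<gamma> (p (Suc i)))) \<le> ennreal (p n - p 0)"
      by (rule ennreal_leI)
  qed
  obtain m q where q: "q 0 = a" "q m = b" "\<And>i. q i \<le> q (Suc i)"
      "\<And>i. dist (\<gamma> (q i)) (\<gamma> (q (Suc i))) = q (Suc i) - q i"
    using unit_speed_partition[OF assms(1,3), of \<gamma>] unit by metis
  have "ennreal (b - a) = ennreal (\<Sum>i<m. dist (\<gamma> (q i)) (\<gamma> (q (Suc i))))"
    using q by (simp add: sum_lessThan_telescope)
  also have "\<dots> \<le> path_length \<gamma> a b"
    unfolding path_length_def using q by (intro SUP_upper2[of "(m, q)"]) auto
  finally show "ennreal (b - a) \<le> path_length \<gamma> a b" .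
qed

section \<open>The unit circle of the l1 norm as a periodic curve\<close>

text \<open>Two triangle waves, a quarter period apart, run counter-clockwise through the l1 unit
  circle with period 4, one edge per unit interval. The trigonometric form gives continuity without
  gluing and reduces injectivity to that of (cos, sin).\<close>

definition diamond_wave :: "real \<Rightarrow> complex" where
  "diamond_wave x = Complex (2 / pi * arcsin (cos (pi / 2 * x))) (2 / pi * arcsin (sin (pi / 2 * x)))"

lemma diamond_wave_base:
  assumes "0 \<le> u" "u \<le> 1"
  shows "diamond_wave u = Complex (1 - u) u"
proof -
  have cos: "cos (pi / 2 * u) = sin (pi / 2 * (1 - u))"
    by (simp add: sin_cos_eq right_diff_distrib)
  have arc: "arcsin (sin (pi / 2 * v)) = pi / 2 * v" if v: "0 \<le> v" "v \<le> 1" for v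
  proof (rule arcsin_sin)
    have "0 \<le> pi / 2 * v" using v by simp
    then show "- (pi / 2) \<le> pi / 2 * v" using pi_gt_zero by linarith
    show "pi / 2 * v \<le> pi / 2" using mult_left_mono[OF v(2), of "pi / 2"] by simp
  qed
  have "diamond_wave u = Complex (2 / pi * (pi / 2 * (1 - u))) (2 / pi * (pi / 2 * u))"
    unfolding diamond_wave_def cos using assms by (subst (1 2) arc) simp_all
  then show ?thesis by simp
qed

text \<open>A unit shift of the parameter is a quarter turn of the diamond, so the first edge
  determines the other three.\<close>

lemma diamond_wave_add_1: "diamond_wave (x + 1) = \<i> * diamond_wave x"
proof -
  have "sin (pi / 2 * (x + 1)) = cos (pi / 2 * x)" "cos (pi / 2 * (x + 1)) = - sin (pi / 2 * x)"
    by (simp_all add: distrib_left sin_add cos_add)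
  then show ?thesis
    by (simp add: diamond_wave_def arcsin_minus complex_eq_iff)
qed

lemma diamond_wave_add_int: "diamond_wave (of_int n + u) = \<i> powi n * diamond_wave u"
proof (induction n rule: int_induct[where k = 0])
  case (step1 i)
  moreover have "of_int (i + 1) + u = (of_int i + u) + 1" by simp
  ultimately show ?case by (simp only: diamond_wave_add_1) (simp add: power_int_add_1')
next
  case (step2 i)
  then show ?case
    using diamond_wave_add_1[of "of_int (i - 1) + u"] by (simp add: power_int_diff algebra_simps)
qed simp

text \<open>Consecutive powers are listed as pairs because a case analysis over edges needs both
  endpoints at once.\<close>

lemma imaginary_unit_powi_cases:
  "(\<i> powi n, \<i> powi (n + 1)) \<in> {(1, \<i>), (\<i>, -1), (-1, -\<i>), (-\<i>, 1)}"
proof -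
  have "\<i> powi n \<in> {1, \<i>, -1, -\<i>}"
  proof (induction n rule: int_induct[where k = 0])
    case (step1 i)
    then show ?case by (auto simp: power_int_add_1')
  next
    case (step2 i)
    then show ?case by (auto simp: power_int_diff)
  qed simp
  then show ?thesis by (auto simp: power_int_add_1')
qed

lemma continuous_on_diamond_wave: "continuous_on S diamond_wave"
  unfolding diamond_wave_def by (intro continuous_intros) auto

lemma diamond_wave_eqD:
  assumes "diamond_wave x = diamond_wave y"
  obtains n :: int where "x = y + 4 * of_int n"
proof -
  have "sin (pi / 2 * x) = sin (pi / 2 * y) \<and> cos (pi / 2 * x) = cos (pi / 2 * y)"
    using assms by (simp add: diamond_wave_def arcsin_eq_iff)
  then obtain n :: int where "pi / 2 * x = pi / 2 * y + 2 * pi * of_int n"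
    by (subst (asm) sin_cos_eq_iff) blast
  then have "pi * x = pi * (y + 4 * of_int n)" by (simp add: algebra_simps)
  then show ?thesis using that by simp
qed

lemma diamond_wave_on_diamond: "\<bar>Re (diamond_wave x)\<bar> + \<bar>Im (diamond_wave x)\<bar> = 1"
proof -
  have "diamond_wave x = \<i> powi \<lfloor>x\<rfloor> * Complex (1 - frac x) (frac x)"
    using diamond_wave_add_int[of "\<lfloor>x\<rfloor>" "frac x"] diamond_wave_base[of "frac x"]
    by (simp add: frac_ge_0 frac_lt_1 less_imp_le) (simp add: frac_def)
  then show ?thesis
    using imaginary_unit_powi_cases[of "\<lfloor>x\<rfloor>"] frac_ge_0[of x] frac_lt_1[of x] by auto
qed

text \<open>If |a| + |b| = 1, the angles pi |a| / 2 and pi |b| / 2 are complementary. Hence the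
  sines of pi a / 2 and pi b / 2 are the coordinates of a point on the Euclidean unit circle, and
  the angle of that point yields the parameter.\<close>

lemma diamond_wave_surj:
  assumes "\<bar>a\<bar> + \<bar>b\<bar> = 1"
  obtains x where "diamond_wave x = Complex a b"
proof -
  have "pi / 2 * \<bar>b\<bar> = pi / 2 - pi / 2 * \<bar>a\<bar>"
    using assms by (metis add_diff_cancel_left' mult.right_neutral right_diff_distrib)
  then have "sin (pi / 2 * \<bar>b\<bar>) = cos (pi / 2 * \<bar>a\<bar>)"
    using cos_sin_eq[of "pi / 2 * \<bar>a\<bar>"] by (simp only: of_real_eq_id id_apply)
  moreover have "(sin (pi / 2 * \<bar>b\<bar>))\<^sup>2 = (sin (pi / 2 * b))\<^sup>2" "cos (pi / 2 * \<bar>a\<bar>) = cos (pi / 2 * a)"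
    by (auto simp: abs_if)
  ultimately have "(sin (pi / 2 * a))\<^sup>2 + (sin (pi / 2 * b))\<^sup>2 = 1"
    by (metis sin_cos_squared_add)
  then obtain t where t: "sin (pi / 2 * a) = cos t" "sin (pi / 2 * b) = sin t"
    by (rule sincos_total_2pi)
  have arc: "arcsin (sin (pi / 2 * c)) = pi / 2 * c" if "\<bar>c\<bar> \<le> 1" for c
  proof (rule arcsin_sin)
    have "\<bar>pi / 2 * c\<bar> \<le> pi / 2 * 1"
      unfolding abs_mult using that by (intro mult_mono) auto
    then show "- (pi / 2) \<le> pi / 2 * c" "pi / 2 * c \<le> pi / 2" by linarith+
  qed
  have "\<bar>a\<bar> \<le> 1" "\<bar>b\<bar> \<le> 1" using assms by linarith+
  then have arcs: "arcsin (cos t) = pi / 2 * a" "arcsin (sin t) = pi / 2 * b"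
    using arc t by metis+
  have arg: "pi / 2 * (2 / pi * t) = t" by simp
  have "diamond_wave (2 / pi * t) = Complex a b"
    unfolding diamond_wave_def arg arcs by simp
  then show ?thesis using that by blast
qed

text \<open>The hypothesis says that z lies strictly to the left of the line directed from a to b;
  for z on the segment the product would be real.\<close>

lemma not_on_linepath_if_left:
  assumes "0 < Im ((b - a) * cnj (b - z))"
  shows "z \<notin> path_image (linepath a b)"
  using assms by (simp add: closed_segment_def) (force simp: algebra_simps)

section \<open>The rhombus and an explicit arclength parametrization of its boundary\<close>

locale rhombus =
  fixes \<epsilon> :: real
  assumes \<epsilon>_pos: "0 < \<epsilon>"
begin

definition \<Omega> :: "complex set" where
  "\<Omega> = convex hull {1, - 1, of_real \<epsilon> * \<i>, - (of_real \<epsilon> * \<i>)}"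

text \<open>The gauge of the rhombus: its closed unit ball is \<Omega>, by
  \<open>\<Omega>_eq\<close>.\<close>

definition rnorm :: "complex \<Rightarrow> real" where "rnorm z = \<bar>Re z\<bar> + \<bar>Im z\<bar> / \<epsilon>"

text \<open>The real-linear map that takes the l1 unit ball to the rhombus.\<close>

definition stretch :: "complex \<Rightarrow> complex" where "stretch z = Complex (Re z) (\<epsilon> * Im z)"

definition side :: real where "side = sqrt (1 + \<epsilon>\<^sup>2)"

text \<open>All four sides have length \<open>side\<close>, so dividing by it gives unit speed. The
  parameter \<open>side * n\<close> belongs to vertex n, with vertex 0 at the tip 1.\<close>

definition curve :: "real \<Rightarrow> complex" where "curve t = stretch (diamond_wave (t / side))"

definition vertex :: "int \<Rightarrow> complex" where "vertex n = stretch (\<i> powi n)"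

definition dir :: "int \<Rightarrow> complex" where "dir n = (vertex (n + 1) - vertex n) / of_real side"

lemma side_pos: "0 < side"
  unfolding side_def by (simp add: add_pos_nonneg)

lemma stretch_sum_scale: "stretch (of_real a * z + of_real b * w) = of_real a * stretch z + of_real b * stretch w"
  by (simp add: stretch_def complex_eq_iff algebra_simps)

lemma vertex_cases:
  "(vertex n, vertex (n + 1)) \<in>
     {(1, of_real \<epsilon> * \<i>), (of_real \<epsilon> * \<i>, -1), (-1, - (of_real \<epsilon> * \<i>)), (- (of_real \<epsilon> * \<i>), 1)}"
  using imaginary_unit_powi_cases[of n] by (auto simp: vertex_def stretch_def complex_eq_iff)

lemma norm_dir: "cmod (dir n) = 1"
proof -
  have "cmod (vertex (n + 1) - vertex n) = side"
    using vertex_cases[of n] by (auto simp: cmod_def side_def)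
  then show ?thesis
    using side_pos by (simp add: dir_def norm_divide)
qed

lemma side_dir: "of_real side * dir n = vertex (n + 1) - vertex n"
  using side_pos by (simp add: dir_def)

lemma curve_on_side:
  assumes "side * of_int n \<le> t" "t \<le> side * of_int (n + 1)"
  shows "curve t = vertex n + of_real (t - side * of_int n) * dir n"
proof -
  define u where "u = t / side - of_int n"
  have u: "0 \<le> u" "u \<le> 1" and t: "t = side * (of_int n + u)"
    using assms side_pos by (auto simp: u_def field_simps)
  have pw: "\<i> powi (n + 1) = \<i> * \<i> powi n"
    by (simp add: power_int_add_1')
  have "diamond_wave (t / side) = \<i> powi n * Complex (1 - u) u"
    using diamond_wave_add_int[of n u] diamond_wave_base[OF u] side_pos by (simp add: t)
  also have "\<dots> = of_real (1 - u) * \<i> powi n + of_real u * \<i> powi (n + 1)"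
    unfolding pw by (simp add: complex_eq_iff algebra_simps)
  finally have "curve t = of_real (1 - u) * vertex n + of_real u * vertex (n + 1)"
    unfolding curve_def vertex_def by (simp only: stretch_sum_scale)
  also have "\<dots> = vertex n + of_real u * (of_real side * dir n)"
    unfolding side_dir by (simp add: algebra_simps)
  finally show ?thesis by (simp add: t algebra_simps)
qed

lemma rnorm_curve: "rnorm (curve t) = 1"
  using diamond_wave_on_diamond[of "t / side"] \<epsilon>_pos
  by (simp add: rnorm_def curve_def stretch_def abs_mult)

lemma curve_surj:
  assumes "rnorm z = 1"
  obtains t where "curve t = z"
proof -
  have "\<bar>Re z\<bar> + \<bar>Im z / \<epsilon>\<bar> = 1"
    using assms \<epsilon>_pos by (simp add: rnorm_def)
  then obtain x where "diamond_wave x = Complex (Re z) (Im z / \<epsilon>)"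
    by (rule diamond_wave_surj)
  then have "curve (side * x) = z"
    using side_pos \<epsilon>_pos by (simp add: curve_def stretch_def complex_eq_iff)
  then show ?thesis using that by blast
qed

lemma curve_eqD:
  assumes "curve s = curve t"
  obtains n :: int where "s = t + of_int n * (4 * side)"
proof -
  have "diamond_wave (s / side) = diamond_wave (t / side)"
    using assms \<epsilon>_pos by (simp add: curve_def stretch_def complex_eq_iff)
  then obtain n :: int where "s / side = t / side + 4 * of_int n"
    by (rule diamond_wave_eqD)
  then have "s = t + of_int n * (4 * side)"
    using side_pos by (simp add: field_simps)
  then show ?thesis using that by blast
qed

lemma curve_periodic: "curve (t + 4 * side) = curve t"
  using diamond_wave_add_int[of 4 "t / side"] side_pos
  by (simp add: curve_def add_divide_distrib add.commute)

lemma continuous_on_curve: "continuous_on S curve"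
  unfolding curve_def stretch_def
  using side_pos
  by (intro continuous_intros continuous_on_compose2[OF continuous_on_diamond_wave]) auto

text \<open>The unit ball of the gauge is convex and contains the four vertices. Conversely, z is a
  convex combination of 0 and the two vertices of its quadrant, with the coordinates of its gauge as
  weights.\<close>

lemma \<Omega>_eq: "\<Omega> = {z. rnorm z \<le> 1}"
proof
  have "convex {z. rnorm z \<le> 1}"
  proof (rule convexI, clarify)
    fix x y :: complex and u v :: real
    assume *: "rnorm x \<le> 1" "rnorm y \<le> 1" "0 \<le> u" "0 \<le> v" "u + v = 1"
    have "\<bar>Re (u *\<^sub>R x + v *\<^sub>R y)\<bar> \<le> u * \<bar>Re x\<bar> + v * \<bar>Re y\<bar>"
      "\<bar>Im (u *\<^sub>R x + v *\<^sub>R y)\<bar> \<le> u * \<bar>Im x\<bar> + v * \<bar>Im y\<bar>"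
      using * abs_triangle_ineq[of "u * Re x" "v * Re y"] abs_triangle_ineq[of "u * Im x" "v * Im y"]
      by (simp_all add: abs_mult)
    then have "rnorm (u *\<^sub>R x + v *\<^sub>R y) \<le> u * \<bar>Re x\<bar> + v * \<bar>Re y\<bar> + (u * \<bar>Im x\<bar> + v * \<bar>Im y\<bar>) / \<epsilon>"
      unfolding rnorm_def using \<epsilon>_pos by (intro add_mono divide_right_mono) auto
    also have "\<dots> = u * rnorm x + v * rnorm y"
      using \<epsilon>_pos by (simp add: rnorm_def field_simps)
    also have "\<dots> \<le> u * 1 + v * 1"
      using * by (intro add_mono mult_left_mono) auto
    finally show "rnorm (u *\<^sub>R x + v *\<^sub>R y) \<le> 1" using * by simp
  qed
  then show "\<Omega> \<subseteq> {z. rnorm z \<le> 1}"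
    unfolding \<Omega>_def using \<epsilon>_pos by (intro hull_minimal) (auto simp: rnorm_def)
  show "{z. rnorm z \<le> 1} \<subseteq> \<Omega>"
  proof clarify
    fix z assume "rnorm z \<le> 1"
    have conv: "convex \<Omega>" unfolding \<Omega>_def by simp
    have in\<Omega>: "1 \<in> \<Omega>" "- 1 \<in> \<Omega>" "of_real \<epsilon> * \<i> \<in> \<Omega>" "- (of_real \<epsilon> * \<i>) \<in> \<Omega>"
      unfolding \<Omega>_def by (auto intro: hull_inc)
    have "(1 / 2) *\<^sub>R 1 + (1 / 2) *\<^sub>R (- 1) \<in> \<Omega>"
      using conv in\<Omega> by (intro convexD) auto
    then have "0 \<in> \<Omega>" by simp
    define p :: complex where "p = (if 0 \<le> Re z then 1 else - 1)"
    define q :: complex where "q = (if 0 \<le> Im z then of_real \<epsilon> * \<i> else - (of_real \<epsilon> * \<i>))"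
    have "convex hull {p, q, 0} \<subseteq> \<Omega>"
      using conv in\<Omega> \<open>0 \<in> \<Omega>\<close> by (intro hull_minimal) (auto simp: p_def q_def)
    moreover have "z = \<bar>Re z\<bar> *\<^sub>R p + (\<bar>Im z\<bar> / \<epsilon>) *\<^sub>R q + (1 - rnorm z) *\<^sub>R 0"
      using \<epsilon>_pos by (auto simp: p_def q_def complex_eq_iff)
    then have "z \<in> convex hull {p, q, 0}"
      unfolding convex_hull_3 mem_Collect_eq using \<open>rnorm z \<le> 1\<close> \<epsilon>_pos
      by (intro exI[of _ "\<bar>Re z\<bar>"] exI[of _ "\<bar>Im z\<bar> / \<epsilon>"] exI[of _ "1 - rnorm z"] conjI)
        (auto simp: rnorm_def)
    ultimately show "z \<in> \<Omega>" by blast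
  qed
qed

lemma convex_\<Omega>: "convex \<Omega>"
  unfolding \<Omega>_def by simp

lemma continuous_on_rnorm: "continuous_on S rnorm"
  unfolding rnorm_def using \<epsilon>_pos by (intro continuous_intros) auto

lemma compact_\<Omega>: "compact \<Omega>"
  unfolding \<Omega>_def by (intro finite_imp_compact_convex_hull) auto

lemma closed_\<Omega>: "closed \<Omega>"
  by (rule compact_imp_closed[OF compact_\<Omega>])

lemma interior_\<Omega>: "interior \<Omega> = {z. rnorm z < 1}"
proof
  have "open {z. rnorm z < 1}"
    by (intro open_Collect_less continuous_on_rnorm continuous_intros)
  then show "{z. rnorm z < 1} \<subseteq> interior \<Omega>"
    by (intro interior_maximal) (auto simp: \<Omega>_eq)
  show "interior \<Omega> \<subseteq> {z. rnorm z < 1}"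
  proof clarify
    fix z assume z: "z \<in> interior \<Omega>"
    show "rnorm z < 1"
    proof (rule ccontr)
      assume "\<not> rnorm z < 1"
      moreover have "rnorm z \<le> 1" using z interior_subset \<Omega>_eq by blast
      ultimately have g: "rnorm z = 1" by simp
      then have "z \<noteq> 0" by (auto simp: rnorm_def)
      obtain e where e: "0 < e" "ball z e \<subseteq> \<Omega>"
        using z by (auto simp: mem_interior)
      have r: "1 < 1 + e / (2 * cmod z)" using \<open>z \<noteq> 0\<close> e(1) by simp
      \<comment> \<open>Pushing a point of gauge 1 outwards by e/2 along its ray stays in the ball
        of radius e but raises the gauge above 1.\<close>
      define w where "w = of_real (1 + e / (2 * cmod z)) * z"
      have "dist z w = e / 2"
        using \<open>z \<noteq> 0\<close> \<open>0 < e\<close> by (simp add: w_def dist_norm algebra_simps norm_mult norm_divide)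
      then have "w \<in> ball z e" using e by simp
      then have "rnorm w \<le> 1" using e(2) by (auto simp: \<Omega>_eq)
      moreover have "rnorm (of_real r * z) = r * rnorm z" if "0 < r" for r
        using that by (simp add: rnorm_def abs_mult algebra_simps)
      ultimately have "(1 + e / (2 * cmod z)) * rnorm z \<le> 1"
        using r unfolding w_def by (metis less_trans zero_less_one)
      then show False using g r by simp
    qed
  qed
qed

lemma frontier_\<Omega>: "frontier \<Omega> = {z. rnorm z = 1}"
  using closed_\<Omega> by (auto simp: frontier_def interior_\<Omega>) (auto simp: \<Omega>_eq)

lemma zero_in_interior: "0 \<in> interior \<Omega>"
  by (simp add: interior_\<Omega> rnorm_def)

text \<open>This is the condition to lie strictly left of side n. For each of the four sides it is
  one of the linear inequalities contained in the gauge bound, and it makes each side contribute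
  positively to the winding number.\<close>

lemma inside_edge:
  assumes "rnorm z < 1"
  shows "0 < Im ((vertex (n + 1) - vertex n) * cnj (vertex (n + 1) - z))"
proof -
  have lt: "\<bar>Re z\<bar> * \<epsilon> + \<bar>Im z\<bar> < \<epsilon>"
    using assms \<epsilon>_pos by (simp add: rnorm_def field_simps)
  have le: "Re z * \<epsilon> \<le> \<bar>Re z\<bar> * \<epsilon>" "- Re z * \<epsilon> \<le> \<bar>Re z\<bar> * \<epsilon>"
    using \<epsilon>_pos by (intro mult_right_mono; simp)+
  show ?thesis
    using vertex_cases[of n] lt le by (auto simp: algebra_simps)
qed

text \<open>The four sides have winding numbers of positive real part about z, so their join does
  too. For a simple closed curve around which this real part is positive, the winding number must be
  1.\<close>

lemma winding_number_curve:
  assumes "rnorm z < 1"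
  shows "winding_number (\<lambda>t. curve (4 * side * t)) z = 1"
proof -
  let ?p = "\<lambda>t. curve (4 * side * t)"
  let ?e = "\<lambda>n. linepath (vertex n) (vertex (n + 1))"
  \<comment> \<open>The balanced bracketing makes the join traverse each side on a quarter of [0,1],
    exactly as the rescaled curve does.\<close>
  let ?q = "(?e 0 +++ ?e 1) +++ (?e 2 +++ ?e 3)"
  have v4: "vertex 4 = vertex 0" by (simp add: vertex_def)
  have seg: "?p t = ?e n (4 * t - of_int n)" if "of_int n \<le> 4 * t" "4 * t \<le> of_int n + 1" for n t
  proof -
    have "?p t = vertex n + of_real (4 * side * t - side * of_int n) * dir n"
      using mult_left_mono[OF that(1), of side] mult_left_mono[OF that(2), of side] side_pos
      by (intro curve_on_side) (auto simp: algebra_simps)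
    also have "of_real (4 * side * t - side * of_int n) * dir n
        = of_real (4 * t - of_int n) * (of_real side * dir n)"
      by (simp add: algebra_simps)
    also note side_dir
    finally show ?thesis by (simp add: linepath_def scaleR_conv_of_real algebra_simps)
  qed
  have eq: "?p t = ?q t" if "0 \<le> t" "t \<le> 1" for t
    using that seg[of 0 t] seg[of 1 t] seg[of 2 t] seg[of 3 t]
    by (auto simp: joinpaths_def)
  have edge: "z \<notin> path_image (?e n)" "0 < Re (winding_number (?e n) z)" for n
    using not_on_linepath_if_left[OF inside_edge[OF assms]]
      winding_number_linepath_pos_lt[OF inside_edge[OF assms]] by auto
  note join = winding_number_join_pos_combined
  have "valid_path (?e 0 +++ ?e 1) \<and> z \<notin> path_image (?e 0 +++ ?e 1) \<and> 0 < Re (winding_number (?e 0 +++ ?e 1) z)"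
    by (rule join) (use edge[of 0] edge[of 1] in auto)
  moreover have "valid_path (?e 2 +++ ?e 3) \<and> z \<notin> path_image (?e 2 +++ ?e 3) \<and> 0 < Re (winding_number (?e 2 +++ ?e 3) z)"
    by (rule join) (use edge[of 2] edge[of 3] v4 in auto)
  ultimately have "valid_path ?q \<and> z \<notin> path_image ?q \<and> 0 < Re (winding_number ?q z)"
    by (intro join) auto
  moreover have "winding_number ?p z = winding_number ?q z"
    using eq by (rule winding_number_cong)
  ultimately have pos: "0 < Re (winding_number ?p z)" by simp
  have "path ?p"
    unfolding path_def by (intro continuous_on_compose2[OF continuous_on_curve] continuous_intros) auto
  moreover have "loop_free ?p"
    unfolding loop_free_def
  proof (intro ballI impI)
    fix x y :: real assume xy: "x \<in> {0..1}" "y \<in> {0..1}" "?p x = ?p y"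
    obtain k :: int where "4 * side * x = 4 * side * y + of_int k * (4 * side)"
      using curve_eqD[OF xy(3)] .
    then have "4 * side * x = 4 * side * (y + of_int k)" by (simp add: algebra_simps)
    then have "x = y + of_int k" using side_pos by simp
    moreover from this have "-1 \<le> k" "k \<le> 1" using xy by auto
    then have "k = -1 \<or> k = 0 \<or> k = 1" by auto
    ultimately show "x = y \<or> x = 0 \<and> y = 1 \<or> x = 1 \<and> y = 0" using xy(1,2) by auto
  qed
  ultimately have "simple_path ?p" by (simp add: simple_path_def)
  moreover have "z \<notin> path_image ?p"
    using rnorm_curve assms by (force simp: path_image_def)
  moreover have "pathfinish ?p = pathstart ?p"
    using curve_periodic[of 0] by (simp add: pathfinish_def pathstart_def)
  ultimately show ?thesis
    using pos by (intro simple_closed_path_winding_number_pos)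
qed

lemma curve_unit_speed:
  assumes "side * of_int n \<le> s" "s \<le> t" "t \<le> side * of_int (n + 1)"
  shows "dist (curve s) (curve t) = t - s"
proof -
  have "curve s = vertex n + of_real (s - side * of_int n) * dir n"
    "curve t = vertex n + of_real (t - side * of_int n) * dir n"
    using assms by (intro curve_on_side; simp)+
  then have "curve s - curve t = of_real (s - t) * dir n"
    by (simp only:) (simp add: algebra_simps)
  then show ?thesis
    using assms norm_dir[of n] by (simp add: dist_norm norm_mult del: of_real_diff)
qed

lemma curve_is_boundary_param: "is_boundary_param \<Omega> (4 * side) curve"
  unfolding is_boundary_param_def
proof (intro conjI allI impI ballI)
  show "inj_on curve {0..<4 * side}"
  proof (rule inj_onI)
    fix s t assume st: "s \<in> {0..<4 * side}" "t \<in> {0..<4 * side}" "curve s = curve t"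
    obtain k :: int where k: "s = t + of_int k * (4 * side)" using curve_eqD[OF st(3)] .
    then have "\<bar>of_int k * (4 * side)\<bar> < 1 * (4 * side)" using st by auto
    then have "\<bar>of_int k :: real\<bar> < 1" using side_pos by (simp add: abs_mult)
    then have "k = 0" by linarith
    then show "s = t" using k by simp
  qed
  have "curve t \<in> curve ` {0..<4 * side}" for t
    using reduce_mod_period[of "4 * side" t] periodic_int[of curve, OF curve_periodic] side_pos
    by (metis imageI mult_pos_pos zero_less_numeral)
  then show "curve ` {0..<4 * side} = frontier \<Omega>"
    unfolding frontier_\<Omega> using rnorm_curve curve_surj by (auto; metis)
  show "path_length curve a b = ennreal (b - a)" if "a \<le> b" for a b
    using side_pos curve_unit_speed that by (rule path_length_unit_speed)
qed (use side_pos continuous_on_curve curve_periodic winding_number_curve interior_\<Omega> in auto)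

text \<open>The explicit curve witnesses that the choice operator picks a genuine parametrization,
  and uniqueness identifies the chosen one with it up to an unknown shift c.\<close>

lemma boundary_curve_eq:
  obtains c where "\<And>t. boundary_curve \<Omega> t = curve (t + c)"
    and "is_boundary_param \<Omega> (4 * side) (boundary_curve \<Omega>)" "perimeter \<Omega> = 4 * side"
proof -
  have "case boundary_param \<Omega> of (L, \<gamma>) \<Rightarrow> is_boundary_param \<Omega> L \<gamma>"
    unfolding boundary_param_def using curve_is_boundary_param
    by (intro someI[of "\<lambda>(L, \<gamma>). is_boundary_param \<Omega> L \<gamma>" "(4 * side, curve)"]) simp
  then have par: "is_boundary_param \<Omega> (perimeter \<Omega>) (boundary_curve \<Omega>)"
    by (simp add: perimeter_def boundary_curve_def split: prod.splits)
  obtain c where "perimeter \<Omega> = 4 * side" "\<And>t. boundary_curve \<Omega> t = curve (t + c)"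
    using boundary_param_unique[OF par curve_is_boundary_param convex_\<Omega> closed_\<Omega> zero_in_interior]
    by metis
  with par that show ?thesis by metis
qed

end

section \<open>Tangents and the Neumann-Poincare density\<close>

lemma cis_eq_imp_eq:
  assumes "cis a = cis b" "\<bar>a - b\<bar> < 2 * pi"
  shows "a = b"
proof -
  have "\<i> * of_real a = \<i> * of_real b"
  proof (rule exp_complex_eqI)
    show "exp (\<i> * of_real a) = exp (\<i> * of_real b)" using assms(1) by (simp only: cis_conv_exp)
  qed (use assms(2) in simp)
  then show ?thesis by simp
qed

lemma affine_has_vector_derivative:
  fixes f :: "real \<Rightarrow> complex"
  assumes "t \<in> S" "\<And>s. s \<in> S \<Longrightarrow> f s = f t + of_real (s - t) * v"
  shows "(f has_vector_derivative v) (at t within S)"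
proof (rule has_vector_derivative_transform[OF assms])
  have "((\<lambda>s. f t + (s - t) *\<^sub>R v) has_vector_derivative v) (at t within S)"
    by (auto intro!: derivative_eq_intros)
  then show "((\<lambda>s. f t + of_real (s - t) * v) has_vector_derivative v) (at t within S)"
    by (simp add: scaleR_conv_of_real)
qed

context rhombus
begin

section \<open>One-sided directions of the curve\<close>

text \<open>Sliding along side n adds a real multiple of \<open>dir n\<close> and leaves the
  imaginary part unchanged, so the point of the curve may be replaced by the end vertex.\<close>

lemma Im_dir_cnj:
  assumes "side * of_int n \<le> t" "t \<le> side * of_int (n + 1)"
  shows "Im (dir n * cnj (curve t - z)) = Im ((vertex (n + 1) - vertex n) * cnj (vertex (n + 1) - z)) / side"
proof -
  have "vertex n = vertex (n + 1) - of_real side * dir n"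
    unfolding side_dir by simp
  then have "curve t - z = (vertex (n + 1) - z) + of_real (t - side * of_int n - side) * dir n"
    unfolding curve_on_side[OF assms] by (simp only:) (simp add: algebra_simps)
  moreover have "Im (d * cnj (w + of_real r * d)) = Im (d * cnj w)" for d w :: complex and r
    by (simp add: algebra_simps)
  ultimately have "Im (dir n * cnj (curve t - z)) = Im (dir n * cnj (vertex (n + 1) - z))"
    by metis
  also have "\<dots> = Im ((vertex (n + 1) - vertex n) * cnj (vertex (n + 1) - z)) / side"
    unfolding dir_def by (metis Im_divide_of_real times_divide_eq_left)
  finally show ?thesis .
qed

text \<open>The weak form of \<open>inside_edge\<close>, valid also for z on the boundary; it is the
  source of the nonnegativity of the density.\<close>

lemma left_of_side:
  assumes "side * of_int n \<le> t" "t \<le> side * of_int (n + 1)" "rnorm z \<le> 1"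
  shows "0 \<le> Im (dir n * cnj (curve t - z))"
proof -
  have le: "\<bar>Re z\<bar> * \<epsilon> + \<bar>Im z\<bar> \<le> \<epsilon>"
    using assms(3) \<epsilon>_pos by (simp add: rnorm_def field_simps)
  have "Re z * \<epsilon> \<le> \<bar>Re z\<bar> * \<epsilon>" "- Re z * \<epsilon> \<le> \<bar>Re z\<bar> * \<epsilon>"
    using \<epsilon>_pos by (intro mult_right_mono; simp)+
  then have "0 \<le> Im ((vertex (n + 1) - vertex n) * cnj (vertex (n + 1) - z))"
    using vertex_cases[of n] le by (auto simp: algebra_simps)
  then show ?thesis
    unfolding Im_dir_cnj[OF assms(1,2)] using side_pos by simp
qed

lemma counterclockwise_about_0:
  assumes "side * of_int n \<le> t" "t \<le> side * of_int (n + 1)"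
  shows "0 < Im (dir n / curve t)"
proof -
  have "0 < Im (dir n * cnj (curve t))"
    using Im_dir_cnj[OF assms, of 0] inside_edge[of 0 n] side_pos by (simp add: rnorm_def)
  moreover have "curve t \<noteq> 0" using rnorm_curve[of t] by (auto simp: rnorm_def)
  ultimately show ?thesis
    by (simp add: Im_complex_div_gt_0)
qed

text \<open>The outgoing direction: at a vertex, the floor selects the side that starts
  there.\<close>

definition rdir :: "real \<Rightarrow> complex" where "rdir t = dir \<lfloor>t / side\<rfloor>"

text \<open>The incoming direction: at a vertex, the ceiling minus one selects the side that ends
  there. Elsewhere it agrees with \<open>rdir\<close>.\<close>

definition ldir :: "real \<Rightarrow> complex" where "ldir t = dir (\<lceil>t / side\<rceil> - 1)"

lemma floor_side: "side * of_int \<lfloor>t / side\<rfloor> \<le> t" "t < side * of_int (\<lfloor>t / side\<rfloor> + 1)"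
  using floor_divide_bounds[OF side_pos, of t] by (simp_all add: mult.commute)

lemma ceiling_side: "side * of_int (\<lceil>t / side\<rceil> - 1) < t" "t \<le> side * of_int (\<lceil>t / side\<rceil> - 1 + 1)"
proof -
  have "of_int \<lceil>t / side\<rceil> - 1 < t / side" "t / side \<le> of_int \<lceil>t / side\<rceil>"
    using ceiling_correct[of "t / side"] by auto
  then show "side * of_int (\<lceil>t / side\<rceil> - 1) < t" "t \<le> side * of_int (\<lceil>t / side\<rceil> - 1 + 1)"
    using side_pos by (simp_all only: pos_less_divide_eq pos_divide_le_eq) (simp_all add: mult.commute)
qed

lemma curve_affine:
  assumes "side * of_int n \<le> s" "s \<le> side * of_int (n + 1)"
    "side * of_int n \<le> t" "t \<le> side * of_int (n + 1)"
  shows "curve s = curve t + of_real (s - t) * dir n"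
  unfolding curve_on_side[OF assms(1,2)] curve_on_side[OF assms(3,4)] by (simp add: algebra_simps)

lemma curve_right:
  obtains d where "0 < d" "d \<le> side" "\<And>s. t \<le> s \<Longrightarrow> s \<le> t + d \<Longrightarrow> curve s = curve t + of_real (s - t) * rdir t"
    "\<And>s. t \<le> s \<Longrightarrow> s < t + d \<Longrightarrow> \<lfloor>s / side\<rfloor> = \<lfloor>t / side\<rfloor>"
proof
  let ?n = "\<lfloor>t / side\<rfloor>"
  \<comment> \<open>The distance to the next vertex. The affine formula holds up to and including
    that vertex, whereas the floor jumps there.\<close>
  let ?d = "side * of_int (?n + 1) - t"
  note fl = floor_side[of t]
  show "0 < ?d" using fl by simp
  show "?d \<le> side" using fl by (simp add: algebra_simps)
  show "curve s = curve t + of_real (s - t) * rdir t" if "t \<le> s" "s \<le> t + ?d" for s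
    unfolding rdir_def using that fl by (intro curve_affine) auto
  show "\<lfloor>s / side\<rfloor> = ?n" if "t \<le> s" "s < t + ?d" for s
  proof (rule floor_unique)
    show "of_int ?n \<le> s / side" "s / side < of_int ?n + 1"
      using fl that side_pos by (simp_all add: field_simps)
  qed
qed

lemma curve_left:
  obtains d where "0 < d" "d \<le> side" "\<And>s. t - d \<le> s \<Longrightarrow> s \<le> t \<Longrightarrow> curve s = curve t + of_real (s - t) * ldir t"
    "\<And>s. t - d \<le> s \<Longrightarrow> s < t \<Longrightarrow> \<lfloor>s / side\<rfloor> = \<lceil>t / side\<rceil> - 1"
proof
  let ?n = "\<lceil>t / side\<rceil> - 1"
  let ?d = "t - side * of_int ?n"
  note cl = ceiling_side[of t]
  show "0 < ?d" using cl by simp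
  show "?d \<le> side" using cl by (simp add: algebra_simps)
  show "curve s = curve t + of_real (s - t) * ldir t" if "t - ?d \<le> s" "s \<le> t" for s
    unfolding ldir_def using that cl by (intro curve_affine) auto
  show "\<lfloor>s / side\<rfloor> = ?n" if "t - ?d \<le> s" "s < t" for s
  proof (rule floor_unique)
    have "side * of_int ?n \<le> s" "s < side * of_int (?n + 1)" using that cl by auto
    then show "of_int ?n \<le> s / side" "s / side < of_int ?n + 1"
      using side_pos by (simp_all add: field_simps)
  qed
qed

lemma vertex_periodic: "vertex (n + 4 * k) = vertex n"
  by (simp add: vertex_def power_int_add power_int_mult)

lemma dir_periodic: "dir (n + 4 * k) = dir n"
  using vertex_periodic[of n k] vertex_periodic[of "n + 1" k] by (simp add: dir_def add_ac)

lemma directions_periodic: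
  assumes "curve s = curve t"
  shows "rdir s = rdir t" "ldir s = ldir t"
proof -
  obtain k :: int where k: "s = t + of_int k * (4 * side)" using curve_eqD[OF assms] .
  have s: "s / side = t / side + of_int (4 * k)" using side_pos by (simp add: k field_simps)
  show "rdir s = rdir t" "ldir s = ldir t"
    unfolding rdir_def ldir_def s floor_add_int ceiling_add_of_int
    using dir_periodic[of "\<lfloor>t / side\<rfloor>" k] dir_periodic[of "\<lceil>t / side\<rceil> - 1" k]
    unfolding floor_add_int[symmetric] by (simp_all only: diff_add_eq)
qed

section \<open>Tangent angles, corners and the unit tangent\<close>

text \<open>The curve is affine on either side of each parameter and one-sided derivatives are
  unique. By \<open>directions_periodic\<close> it does not matter which parameter represents the
  point, and the unknown shift disappears.\<close>

lemma tangent_angles_iff: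
  "tangent_angles \<Omega> (curve t) \<alpha> \<beta> \<longleftrightarrow> cis \<alpha> = ldir t \<and> cis \<beta> = rdir t \<and> 0 \<le> \<beta> - \<alpha> \<and> \<beta> - \<alpha> < pi"
proof -
  obtain c where c: "\<And>t. boundary_curve \<Omega> t = curve (t + c)"
    using boundary_curve_eq by metis
  have right: "(boundary_curve \<Omega> has_vector_derivative rdir (s + c)) (at_right s)" for s
  proof -
    obtain d where d: "0 < d" "\<And>u. s + c \<le> u \<Longrightarrow> u \<le> s + c + d \<Longrightarrow> curve u = curve (s + c) + of_real (u - (s + c)) * rdir (s + c)"
      using curve_right[of "s + c"] by metis
    have "(boundary_curve \<Omega> has_vector_derivative rdir (s + c)) (at s within {s..s+d})"
    proof (rule affine_has_vector_derivative)
      show "boundary_curve \<Omega> u = boundary_curve \<Omega> s + of_real (u - s) * rdir (s + c)" if "u \<in> {s..s+d}" for u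
        using that d(2)[of "u + c"] unfolding c by simp
    qed (use d(1) in simp)
    then show ?thesis using d(1) by (simp add: at_within_Icc_at_right)
  qed
  have left: "(boundary_curve \<Omega> has_vector_derivative ldir (s + c)) (at_left s)" for s
  proof -
    obtain d where d: "0 < d" "\<And>u. s + c - d \<le> u \<Longrightarrow> u \<le> s + c \<Longrightarrow> curve u = curve (s + c) + of_real (u - (s + c)) * ldir (s + c)"
      using curve_left[of "s + c"] by metis
    have "(boundary_curve \<Omega> has_vector_derivative ldir (s + c)) (at s within {s - d..s})"
    proof (rule affine_has_vector_derivative)
      show "boundary_curve \<Omega> u = boundary_curve \<Omega> s + of_real (u - s) * ldir (s + c)" if "u \<in> {s - d..s}" for u
        using that d(2)[of "u + c"] unfolding c by simp
    qed (use d(1) in simp)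
    then show ?thesis using d(1) by (simp add: at_within_Icc_at_left)
  qed
  have derivs: "(boundary_curve \<Omega> has_vector_derivative u) (at_left s) \<longleftrightarrow> u = ldir (s + c)"
    "(boundary_curve \<Omega> has_vector_derivative u) (at_right s) \<longleftrightarrow> u = rdir (s + c)" for s u
    using left[of s] right[of s]
    by (auto intro: vector_derivative_unique_within[OF trivial_limit_at_left_real]
        vector_derivative_unique_within[OF trivial_limit_at_right_real])
  show ?thesis
    unfolding tangent_angles_def derivs c
  proof safe
    fix s assume s: "curve (s + c) = curve t" "cis \<alpha> = ldir (s + c)" "cis \<beta> = rdir (s + c)"
    show "cis \<alpha> = ldir t" "cis \<beta> = rdir t"
      using s directions_periodic[OF s(1)] by simp_all
  next
    assume "cis \<alpha> = ldir t" "cis \<beta> = rdir t"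
    then show "\<exists>s. curve (s + c) = curve t \<and> cis \<alpha> = ldir (s + c) \<and> cis \<beta> = rdir (s + c)"
      by (intro exI[of _ "t - c"]) simp
  qed
qed

lemma vertex_params:
  assumes "t / side \<in> \<int>"
  obtains n where "t = side * of_int n" "rdir t = dir n" "ldir t = dir (n - 1)" "curve t = vertex n"
proof -
  obtain n where n: "t / side = of_int n" using assms by (rule Ints_cases)
  then have t: "t = side * of_int n" using side_pos by (simp add: field_simps)
  moreover have "curve t = vertex n"
    using curve_on_side[of n t] side_pos by (simp add: t)
  moreover have "rdir t = dir n" "ldir t = dir (n - 1)"
    unfolding rdir_def ldir_def n by simp_all
  ultimately show ?thesis using that by blast
qed

lemma directions_on_side:
  assumes "t / side \<notin> \<int>"
  shows "ldir t = rdir t"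
proof -
  have "\<lceil>t / side\<rceil> = \<lfloor>t / side\<rfloor> + 1"
    using assms by (metis Ints_of_int ceiling_altdef)
  then show ?thesis by (simp add: rdir_def ldir_def)
qed

lemma cis_Arg_dir: "cis (Arg (dir n)) = dir n"
  using norm_dir[of n] by (subst cis_Arg) (auto simp: sgn_eq)

text \<open>The curve makes a strict left turn, by an angle between 0 and pi, so every vertex is a
  corner.\<close>

lemma turn_at_vertex: "0 < Im (dir n / dir (n - 1))"
proof -
  have "0 < Im ((vertex (n + 1) - vertex n) * cnj (vertex n - vertex (n - 1)))"
    using vertex_cases[of n] vertex_cases[of "n - 1"] \<epsilon>_pos by (auto simp: complex_eq_iff)
  moreover have "dir n * cnj (dir (n - 1)) =
      (vertex (n + 1) - vertex n) * cnj (vertex n - vertex (n - 1)) / of_real (side * side)"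
    by (simp add: dir_def)
  ultimately have "0 < Im (dir n * cnj (dir (n - 1)))"
    using side_pos by (simp only: Im_divide_of_real) simp
  moreover have "dir (n - 1) \<noteq> 0" using norm_dir[of "n - 1"] by auto
  ultimately show ?thesis by (simp add: Im_complex_div_gt_0)
qed

text \<open>At a vertex the outgoing angle is the incoming one plus the argument of the turn, rather
  than the principal argument of the outgoing side; this keeps the difference between 0 and pi
  across the branch cut.\<close>

lemma tangent_angles_exist:
  obtains \<alpha> \<beta> where "tangent_angles \<Omega> (curve t) \<alpha> \<beta>" "\<alpha> < \<beta> \<longleftrightarrow> t / side \<in> \<int>"
proof (cases "t / side \<in> \<int>")
  case True
  then obtain n where n: "rdir t = dir n" "ldir t = dir (n - 1)" using vertex_params by metis
  define \<alpha> where "\<alpha> = Arg (dir (n - 1))"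
  define \<omega> where "\<omega> = Arg (dir n / dir (n - 1))"
  have \<omega>: "0 < \<omega>" "\<omega> < pi"
    using turn_at_vertex[of n] Arg_lt_pi[of "dir n / dir (n - 1)"] by (auto simp: \<omega>_def)
  have "cis \<omega> = dir n / dir (n - 1)"
    unfolding \<omega>_def using norm_dir[of n] norm_dir[of "n - 1"]
    by (subst cis_Arg) (auto simp: sgn_eq norm_divide)
  then have "cis (\<alpha> + \<omega>) = dir n"
    using cis_Arg_dir[of "n - 1"] norm_dir[of "n - 1"] by (auto simp: \<alpha>_def simp flip: cis_mult)
  then have "tangent_angles \<Omega> (curve t) \<alpha> (\<alpha> + \<omega>)"
    unfolding tangent_angles_iff n using \<omega> cis_Arg_dir[of "n - 1"] by (simp add: \<alpha>_def)
  then show ?thesis using that[of \<alpha> "\<alpha> + \<omega>"] \<omega> True by simp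
next
  case False
  have "tangent_angles \<Omega> (curve t) (Arg (rdir t)) (Arg (rdir t))"
    unfolding tangent_angles_iff directions_on_side[OF False]
    by (simp add: rdir_def cis_Arg_dir)
  then show ?thesis using that False by blast
qed

text \<open>Both differences lie in [0, pi) and have the same \<open>cis\<close>. This makes the
  definite description in \<open>interior_angle\<close> well defined.\<close>

lemma tangent_angles_diff_unique:
  assumes "tangent_angles \<Omega> (curve t) \<alpha> \<beta>" "tangent_angles \<Omega> (curve t) \<alpha>' \<beta>'"
  shows "\<beta> - \<alpha> = \<beta>' - \<alpha>'"
proof (rule cis_eq_imp_eq)
  show "cis (\<beta> - \<alpha>) = cis (\<beta>' - \<alpha>')"
    using assms by (simp add: tangent_angles_iff flip: cis_divide)
  show "\<bar>\<beta> - \<alpha> - (\<beta>' - \<alpha>')\<bar> < 2 * pi"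
    using assms unfolding tangent_angles_iff by linarith
qed

lemma is_corner_iff: "is_corner \<Omega> (curve t) \<longleftrightarrow> t / side \<in> \<int>"
proof -
  obtain \<alpha> \<beta> where *: "tangent_angles \<Omega> (curve t) \<alpha> \<beta>" "\<alpha> < \<beta> \<longleftrightarrow> t / side \<in> \<int>"
    using tangent_angles_exist .
  then show ?thesis
    unfolding is_corner_def by (metis diff_gt_0_iff_gt tangent_angles_diff_unique)
qed

lemma interior_angle_eq:
  assumes "tangent_angles \<Omega> (curve t) \<alpha> \<beta>"
  shows "interior_angle \<Omega> (curve t) = pi - \<beta> + \<alpha>"
  unfolding interior_angle_def
proof (rule the_equality)
  show "\<exists>\<alpha>' \<beta>'. tangent_angles \<Omega> (curve t) \<alpha>' \<beta>' \<and> pi - \<beta> + \<alpha> = pi - \<beta>' + \<alpha>'"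
    using assms by blast
  show "\<theta> = pi - \<beta> + \<alpha>"
    if "\<exists>\<alpha>' \<beta>'. tangent_angles \<Omega> (curve t) \<alpha>' \<beta>' \<and> \<theta> = pi - \<beta>' + \<alpha>'" for \<theta>
    using that tangent_angles_diff_unique[OF assms] by force
qed

lemma unit_tangent_eq:
  assumes "t / side \<notin> \<int>"
  shows "unit_tangent \<Omega> (curve t) = rdir t"
  unfolding unit_tangent_def tangent_angles_iff
proof (rule the_equality)
  show "\<exists>\<alpha>. (cis \<alpha> = ldir t \<and> cis \<alpha> = rdir t \<and> 0 \<le> \<alpha> - \<alpha> \<and> \<alpha> - \<alpha> < pi) \<and> rdir t = cis \<alpha>"
    unfolding directions_on_side[OF assms]
    by (intro exI[of _ "Arg (rdir t)"]) (simp add: rdir_def cis_Arg_dir)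
qed auto

text \<open>Corners and tangents are expressed by the signs of the coordinates of the point, without
  the parameter, which makes the density a visibly Borel function on the plane.\<close>

lemma sign_pattern:
  shows "t / side \<in> \<int> \<longleftrightarrow> Re (curve t) = 0 \<or> Im (curve t) = 0"
    and "t / side \<notin> \<int> \<Longrightarrow>
      rdir t = Complex (- sgn (Im (curve t))) (\<epsilon> * sgn (Re (curve t))) / of_real side"
proof -
  have on: "Re (curve t) = 0 \<or> Im (curve t) = 0" if Z: "t / side \<in> \<int>"
  proof -
    obtain n where "curve t = vertex n" using vertex_params[OF Z] by metis
    then show ?thesis using vertex_cases[of n] by auto
  qed
  have off: "Re (curve t) \<noteq> 0 \<and> Im (curve t) \<noteq> 0 \<and>
      rdir t = Complex (- sgn (Im (curve t))) (\<epsilon> * sgn (Re (curve t))) / of_real side" if "t / side \<notin> \<int>"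
  proof -
    define n where "n = \<lfloor>t / side\<rfloor>"
    define u where "u = t / side - of_int n"
    have "u \<noteq> 0" using that unfolding u_def by (metis Ints_of_int eq_iff_diff_eq_0)
    then have u: "0 < u" "u < 1" using floor_correct[of "t / side"] unfolding u_def n_def by linarith+
    have "t - side * of_int n = side * u" using side_pos by (simp add: u_def field_simps)
    then have "curve t = vertex n + of_real u * (of_real side * dir n)"
      using curve_on_side[of n t] floor_side[of t] by (simp add: n_def mult.left_commute)
    then have cur: "curve t = vertex n + of_real u * (vertex (n + 1) - vertex n)"
      unfolding side_dir .
    show ?thesis
      unfolding rdir_def n_def[symmetric] dir_def cur
      using vertex_cases[of n] u \<epsilon>_pos side_pos
      by (elim insertE emptyE; clarsimp simp: complex_eq_iff sgn_if right_diff_distrib left_diff_distrib mult.commute)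
        (simp add: mult_less_0_iff)
  qed
  show "t / side \<in> \<int> \<longleftrightarrow> Re (curve t) = 0 \<or> Im (curve t) = 0" using on off by blast
  show "t / side \<notin> \<int> \<Longrightarrow>
      rdir t = Complex (- sgn (Im (curve t))) (\<epsilon> * sgn (Re (curve t))) / of_real side"
    using off by blast
qed

section \<open>A Borel formula for the density\<close>

text \<open>It agrees with \<open>np_density\<close> on the frontier. The tangent is read off from
  coordinate signs, and the imaginary part appears because the normal is -i times the
  tangent.\<close>

definition explicit_density :: "complex \<Rightarrow> complex \<Rightarrow> real" where
  "explicit_density \<zeta> \<sigma> =
     (if \<sigma> = \<zeta> \<or> Re \<sigma> = 0 \<or> Im \<sigma> = 0 then 0
      else 1 / pi * Im ((of_real (- sgn (Im \<sigma>)) + \<i> * of_real (\<epsilon> * sgn (Re \<sigma>))) / of_real side / (\<sigma> - \<zeta>)))"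

lemma explicit_density_measurable [measurable]: "explicit_density \<zeta> \<in> borel_measurable borel"
  unfolding explicit_density_def by measurable

lemma np_density_eq:
  assumes "\<sigma> \<in> frontier \<Omega>"
  shows "np_density \<Omega> \<zeta> \<sigma> = explicit_density \<zeta> \<sigma>"
proof -
  obtain t where t: "curve t = \<sigma>" using assms curve_surj by (auto simp: frontier_\<Omega>)
  show ?thesis
  proof (cases "t / side \<in> \<int>")
    case True
    then show ?thesis
      using is_corner_iff[of t] sign_pattern(1)[of t]
      by (auto simp: np_density_def explicit_density_def t)
  next
    case False
    have rot: "Re (- \<i> * x / w) = Im (x / w)" for x w :: complex
    proof -
      have "Re (- \<i> * z) = Im z" for z by simp
      then show ?thesis by (metis times_divide_eq_right)
    qed
    show ?thesis
      using False is_corner_iff[of t] sign_pattern[of t] unit_tangent_eq[of t]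
      unfolding t np_density_def explicit_density_def outward_normal_def rot
      by (simp add: Complex_eq)
  qed
qed

lemma explicit_density_curve:
  assumes "t / side \<notin> \<int>" "curve t \<noteq> \<zeta>"
  shows "explicit_density \<zeta> (curve t) = 1 / pi * Im (rdir t / (curve t - \<zeta>))"
  using assms sign_pattern[of t] by (simp add: explicit_density_def Complex_eq)

lemma explicit_density_nonneg:
  assumes "rnorm \<zeta> \<le> 1"
  shows "0 \<le> explicit_density \<zeta> (curve t)"
proof (cases "t / side \<in> \<int> \<or> curve t = \<zeta>")
  case True
  then show ?thesis using sign_pattern(1)[of t] by (auto simp: explicit_density_def)
next
  case False
  have "0 \<le> Im (rdir t * cnj (curve t - \<zeta>))"
    unfolding rdir_def using floor_side[of t] assms by (intro left_of_side) auto
  then have "0 \<le> Im (rdir t / (curve t - \<zeta>))"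
    by (simp add: Im_complex_div_ge_0)
  then show ?thesis using False by (simp add: explicit_density_curve)
qed

end

section \<open>Total mass of the Neumann-Poincare measure\<close>

lemma nn_integral_shift_indicator:
  fixes f :: "real \<Rightarrow> ennreal"
  assumes [measurable]: "f \<in> borel_measurable borel"
  shows "(\<integral>\<^sup>+ t. f t * indicator {a + c..<b + c} t \<partial>lborel) =
    (\<integral>\<^sup>+ t. f (t + c) * indicator {a..<b} t \<partial>lborel)"
proof -
  have "(\<integral>\<^sup>+ t. f t * indicator {a + c..<b + c} t \<partial>lborel) =
      (\<integral>\<^sup>+ t. f (c + 1 * t) * indicator {a + c..<b + c} (c + 1 * t) \<partial>lborel)"
    by (subst nn_integral_real_affine[where c = 1 and t = c]) simp_all
  also have "\<dots> = (\<integral>\<^sup>+ t. f (t + c) * indicator {a..<b} t \<partial>lborel)"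
    by (intro nn_integral_cong) (simp add: indicator_def add.commute[of c])
  finally show ?thesis .
qed

text \<open>The piece over [a, b) lost on the left reappears over [a + L, b + L) on the
  right.\<close>

lemma nn_integral_period_cong:
  fixes f :: "real \<Rightarrow> ennreal"
  assumes [measurable]: "f \<in> borel_measurable borel"
    and per: "\<And>t. f (t + L) = f t" and "a \<le> b" "b \<le> a + L"
  shows "(\<integral>\<^sup>+ t. f t * indicator {a..<a + L} t \<partial>lborel) = (\<integral>\<^sup>+ t. f t * indicator {b..<b + L} t \<partial>lborel)"
proof -
  have split: "(\<integral>\<^sup>+ t. f t * indicator {x..<z} t \<partial>lborel) =
      (\<integral>\<^sup>+ t. f t * indicator {x..<y} t \<partial>lborel) + (\<integral>\<^sup>+ t. f t * indicator {y..<z} t \<partial>lborel)"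
    if "x \<le> y" "y \<le> z" for x y z
  proof -
    have "f t * indicator {x..<z} t = f t * indicator {x..<y} t + f t * indicator {y..<z} t" for t
      using that by (auto simp: indicator_def)
    then show ?thesis by (simp add: nn_integral_add)
  qed
  have "(\<integral>\<^sup>+ t. f t * indicator {a + L..<b + L} t \<partial>lborel) = (\<integral>\<^sup>+ t. f t * indicator {a..<b} t \<partial>lborel)"
    by (subst nn_integral_shift_indicator) (simp_all add: per)
  then show ?thesis
    using split[of a b "a + L"] split[of b "a + L" "b + L"] assms(3,4) by (simp add: add.commute)
qed

context rhombus
begin

section \<open>Integrating the density as the derivative of an argument\<close>

text \<open>Near \<zeta> the curve runs straight, so \<sigma> - \<zeta> is a real multiple of the
  tangent and the kernel vanishes. The singularity can therefore be cut out at no cost.\<close>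

lemma density_near_base_point:
  "\<exists>d>0. d \<le> side \<and>
    (\<forall>s\<in>{t0..t0 + d}. explicit_density (curve t0) (curve s) = 0 \<and>
      curve s = curve t0 + of_real (s - t0) * rdir t0) \<and>
    (\<forall>s\<in>{t0 - d..t0}. explicit_density (curve t0) (curve s) = 0 \<and>
      curve s = curve t0 + of_real (s - t0) * ldir t0)"
proof -
  let ?\<zeta> = "curve t0"
  have vanish: "explicit_density ?\<zeta> (curve s) = 0"
    if "curve s = ?\<zeta> + of_real (s - t0) * v" "rdir s = v" for s v
  proof (cases "s / side \<in> \<int> \<or> curve s = ?\<zeta>")
    case True
    then show ?thesis using sign_pattern(1)[of s] by (auto simp: explicit_density_def)
  next
    case False
    then have "explicit_density ?\<zeta> (curve s) = 1 / pi * Im (rdir s / (curve s - ?\<zeta>))"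
      by (intro explicit_density_curve) auto
    also have "rdir s / (curve s - ?\<zeta>) = 1 / of_real (s - t0)"
      using that False by auto
    finally show ?thesis by simp
  qed
  obtain d1 where d1: "0 < d1" "d1 \<le> side"
      "\<And>s. t0 \<le> s \<Longrightarrow> s \<le> t0 + d1 \<Longrightarrow> curve s = ?\<zeta> + of_real (s - t0) * rdir t0"
      "\<And>s. t0 \<le> s \<Longrightarrow> s < t0 + d1 \<Longrightarrow> \<lfloor>s / side\<rfloor> = \<lfloor>t0 / side\<rfloor>"
    using curve_right[of t0] by metis
  obtain d2 where d2: "0 < d2" "d2 \<le> side"
      "\<And>s. t0 - d2 \<le> s \<Longrightarrow> s \<le> t0 \<Longrightarrow> curve s = ?\<zeta> + of_real (s - t0) * ldir t0"
      "\<And>s. t0 - d2 \<le> s \<Longrightarrow> s < t0 \<Longrightarrow> \<lfloor>s / side\<rfloor> = \<lceil>t0 / side\<rceil> - 1"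
    using curve_left[of t0] by metis
  \<comment> \<open>Halving fits the closed interval on the right into the half-open one on which
    the floor is constant.\<close>
  let ?d = "min d1 d2 / 2"
  have d: "0 < ?d" "?d < d1" "?d < d2" "?d \<le> side" using d1(1,2) d2(1,2) by auto
  show ?thesis
  proof (intro exI[of _ ?d] conjI ballI)
    fix s assume s: "s \<in> {t0..t0 + ?d}"
    then show "curve s = ?\<zeta> + of_real (s - t0) * rdir t0" using d by (intro d1(3)) auto
    moreover have "rdir s = rdir t0" using s d d1(4)[of s] by (simp add: rdir_def)
    ultimately show "explicit_density ?\<zeta> (curve s) = 0" by (rule vanish)
  next
    fix s assume s: "s \<in> {t0 - ?d..t0}"
    then show cur: "curve s = ?\<zeta> + of_real (s - t0) * ldir t0" using d by (intro d2(3)) auto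
    show "explicit_density ?\<zeta> (curve s) = 0"
    proof (cases "s = t0")
      case True
      then show ?thesis by (simp add: explicit_density_def)
    next
      case False
      then have "rdir s = ldir t0" using s d d2(4)[of s] by (simp add: rdir_def ldir_def)
      then show ?thesis by (rule vanish[OF cur])
    qed
  qed (use d in auto)
qed

lemma curve_ne_0: "curve t \<noteq> 0"
  using rnorm_curve[of t] by (auto simp: rnorm_def)

lemma curve_has_vector_derivative:
  assumes "t / side \<notin> \<int>"
  shows "(curve has_vector_derivative rdir t) (at t)"
proof -
  let ?n = "\<lfloor>t / side\<rfloor>"
  let ?S = "{side * of_int ?n<..<side * of_int (?n + 1)}"
  have "t \<noteq> side * of_int ?n"
    using assms side_pos by (metis Ints_of_int less_numeral_extra(3) nonzero_mult_div_cancel_left)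
  then have t: "t \<in> ?S" using floor_side[of t] by auto
  have "(curve has_vector_derivative rdir t) (at t within ?S)"
    unfolding rdir_def using t by (intro affine_has_vector_derivative curve_affine) auto
  then show ?thesis using at_within_open[OF t open_greaterThanLessThan] by metis
qed

text \<open>
  The argument is taken of \<open>1 - \<sigma> / \<zeta>\<close>, i.e. of \<open>\<sigma> - \<zeta>\<close> measured against the direction from
  \<open>\<zeta>\<close> to the origin, as this avoids the branch cut for all boundary points \<open>\<sigma> \<noteq> \<zeta>\<close>.
\<close>

lemma boundary_avoids_branch_cut:
  assumes "curve s \<noteq> curve t"
  shows "1 - curve s / curve t \<notin> \<real>\<^sub>\<le>\<^sub>0"
proof
  assume "1 - curve s / curve t \<in> \<real>\<^sub>\<le>\<^sub>0"
  then obtain r where r: "1 - curve s / curve t = of_real r" "r \<le> 0"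
    by (auto elim: nonpos_Reals_cases)
  then have "curve s / curve t = of_real (1 - r)" by (simp add: algebra_simps)
  then have s: "curve s = of_real (1 - r) * curve t"
    using curve_ne_0[of t] by (metis nonzero_divide_eq_eq)
  \<comment> \<open>On the branch cut, the point would be \<zeta> scaled by a factor 1 - r of at
    least 1; as both have gauge 1, they would coincide.\<close>
  have "rnorm (curve s) = (1 - r) * rnorm (curve t)"
    unfolding s using r(2) by (simp add: rnorm_def abs_mult distrib_left)
  then have "r = 0" by (simp add: rnorm_curve)
  then show False using s assms by simp
qed

text \<open>By the chain rule, the logarithm of 1 - \<gamma>(s) / \<zeta> has derivative
  \<gamma>'(s) / (\<gamma>(s) - \<zeta>), whose imaginary part is pi times the density. The
  fundamental theorem tolerates the finitely many vertices where the curve is not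
  differentiable.\<close>

lemma density_has_integral:
  assumes t0: "t0 < a" "a \<le> b" "b < t0 + 4 * side"
  shows "((\<lambda>s. explicit_density (curve t0) (curve s)) has_integral
    (Arg (1 - curve b / curve t0) - Arg (1 - curve a / curve t0)) / pi) {a..b}"
proof -
  let ?\<zeta> = "curve t0"
  let ?w = "\<lambda>s. 1 - curve s / ?\<zeta>"
  define F where "F = (\<lambda>s. Im (Ln (?w s)) / pi)"
  \<comment> \<open>Strictly between t0 and t0 plus one period, the curve does not return to
    \<zeta>.\<close>
  have ne: "curve s \<noteq> ?\<zeta>" if "s \<in> {a..b}" for s
  proof
    assume "curve s = ?\<zeta>"
    then obtain k :: int where k: "s = t0 + of_int k * (4 * side)" by (rule curve_eqD)
    then have "0 * (4 * side) < of_int k * (4 * side)" "of_int k * (4 * side) < 1 * (4 * side)"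
      using that t0 k unfolding atLeastAtMost_iff by linarith+
    then have "0 < (of_int k :: real)" "(of_int k :: real) < 1"
      using side_pos by (simp_all only: mult_less_cancel_right)
    then have "0 < k" "k < 1" by simp_all
    then show False by simp
  qed
  have cut: "?w s \<notin> \<real>\<^sub>\<le>\<^sub>0" if "s \<in> {a..b}" for s
    using boundary_avoids_branch_cut[OF ne[OF that]] .
  have F_Arg: "F s = Arg (?w s) / pi" if "s \<in> {a..b}" for s
  proof -
    have "?w s \<noteq> 0" using cut[OF that] by (metis nonpos_Reals_zero_I)
    then show ?thesis unfolding F_def by (metis Arg_eq_Im_Ln)
  qed
  define S where "S = (\<lambda>n :: int. side * of_int n) ` {\<lfloor>a / side\<rfloor>..\<lceil>b / side\<rceil>}"
  have S: "s / side \<notin> \<int>" if "s \<in> {a<..<b} - S" for s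
  proof
    assume "s / side \<in> \<int>"
    then obtain n where n: "s / side = of_int n" by (rule Ints_cases)
    then have "s = side * of_int n" using side_pos by (simp add: field_simps)
    moreover have "a / side \<le> of_int n" "of_int n \<le> b / side"
      using that side_pos unfolding n[symmetric] by (simp_all add: divide_le_cancel)
    then have "\<lfloor>a / side\<rfloor> \<le> n" "n \<le> \<lceil>b / side\<rceil>" by linarith+
    then have "n \<in> {\<lfloor>a / side\<rfloor>..\<lceil>b / side\<rceil>}" by simp
    ultimately show False using that by (auto simp: S_def)
  qed
  have "((\<lambda>s. explicit_density ?\<zeta> (curve s)) has_integral (F b - F a)) {a..b}"
  proof (rule fundamental_theorem_of_calculus_interior_strong)
    show "finite S" by (simp add: S_def)
    show "continuous_on {a..b} F"
      unfolding F_def using cut curve_ne_0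
      by (intro continuous_intros continuous_on_curve) auto
    fix s assume s: "s \<in> {a<..<b} - S"
    then have sab: "s \<in> {a..b}" by auto
    have "((\<lambda>z. Ln (1 - z / ?\<zeta>)) has_field_derivative 1 / (curve s - ?\<zeta>)) (at (curve s))"
    proof -
      have "((\<lambda>z. 1 - z / ?\<zeta>) has_field_derivative - (1 / ?\<zeta>)) (at (curve s))"
        using curve_ne_0[of t0] by (auto intro!: derivative_eq_intros)
      then have "((\<lambda>z. Ln (1 - z / ?\<zeta>)) has_field_derivative inverse (?w s) * - (1 / ?\<zeta>)) (at (curve s))"
        using cut[OF sab] by (intro DERIV_chain2[of Ln]) (auto intro: has_field_derivative_Ln)
      moreover have "?w s = - ((curve s - ?\<zeta>) / ?\<zeta>)"
        using curve_ne_0[of t0] by (simp add: diff_divide_distrib)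
      then have "inverse (?w s) * - (1 / ?\<zeta>) = 1 / (curve s - ?\<zeta>)"
        using curve_ne_0[of t0] by (simp add: divide_inverse)
      ultimately show ?thesis by simp
    qed
    from field_vector_diff_chain_at[OF curve_has_vector_derivative[OF S[OF s]] this]
    have "((\<lambda>s. Ln (?w s)) has_vector_derivative rdir s * (1 / (curve s - ?\<zeta>))) (at s)"
      by (simp add: o_def)
    then have "((\<lambda>s. 1 / pi * Im (Ln (?w s))) has_vector_derivative 1 / pi * Im (rdir s * (1 / (curve s - ?\<zeta>)))) (at s)"
      by (rule bounded_linear.has_vector_derivative[OF bounded_linear_compose[OF bounded_linear_mult_right bounded_linear_Im]])
    then show "(F has_vector_derivative explicit_density ?\<zeta> (curve s)) (at s)"
      using explicit_density_curve[OF S[OF s] ne[OF sab]] by (simp add: F_def)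
  qed (use t0 in auto)
  then show ?thesis
    using t0 by (simp add: F_Arg diff_divide_distrib)
qed

text \<open>The two arguments belong to arrival at and departure from the base point, relative to
  its direction from 0. Counter-clockwise motion puts the first in (0, pi) and the second in (-pi,
  0); together with equality of \<open>cis\<close>, this excludes an error of 2 pi.\<close>

lemma Arg_turn:
  assumes "tangent_angles \<Omega> (curve t) \<alpha> \<beta>"
  shows "Arg (ldir t / curve t) - Arg (- rdir t / curve t) = pi - \<beta> + \<alpha>"
proof (rule cis_eq_imp_eq)
  note tan = assms[unfolded tangent_angles_iff]
  have "0 < Im (ldir t / curve t)" "0 < Im (rdir t / curve t)"
    unfolding ldir_def rdir_def using floor_side[of t] ceiling_side[of t]
    by (auto intro!: counterclockwise_about_0 simp del: of_int_add of_int_diff)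
  then have "0 < Arg (ldir t / curve t)" "Arg (ldir t / curve t) < pi" "Arg (- rdir t / curve t) < 0"
    using Arg_lt_pi[of "ldir t / curve t"] Arg_less_0[of "- rdir t / curve t"] by auto
  then show "\<bar>Arg (ldir t / curve t) - Arg (- rdir t / curve t) - (pi - \<beta> + \<alpha>)\<bar> < 2 * pi"
    using mpi_less_Arg[of "- rdir t / curve t"] tan by linarith
  have ne: "ldir t \<noteq> 0" "rdir t \<noteq> 0"
    using norm_dir by (auto simp: ldir_def rdir_def dest: arg_cong[of _ _ cmod])
  have norm: "cmod (ldir t) = 1" "cmod (rdir t) = 1"
    using norm_dir by (simp_all add: ldir_def rdir_def)
  have "cis (Arg (ldir t / curve t) - Arg (- rdir t / curve t)) =
      sgn (ldir t / curve t) / sgn (- rdir t / curve t)"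
    using ne curve_ne_0[of t] by (simp add: cis_Arg flip: cis_divide)
  also have "\<dots> = - (ldir t / rdir t)"
    using ne curve_ne_0[of t] norm by (simp add: sgn_eq norm_divide field_simps)
  also have "\<dots> = cis (pi - \<beta> + \<alpha>)"
    using tan by (simp add: cis_mult[symmetric] cis_divide[symmetric])
  finally show "cis (Arg (ldir t / curve t) - Arg (- rdir t / curve t)) = cis (pi - \<beta> + \<alpha>)" .
qed

text \<open>Since the curve is straight near both ends of the period, the arguments at the
  truncation points are exactly those of the one-sided directions, so no limit is taken. The
  function \<open>H\<close> drops only stretches where the density is zero.\<close>

lemma density_integral:
  "(\<integral>\<^sup>+ s. ennreal (explicit_density (curve t0) (curve s)) * indicator {t0..<t0 + 4 * side} s \<partial>lborel)
    = ennreal (interior_angle \<Omega> (curve t0) / pi)"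
proof -
  let ?\<zeta> = "curve t0" and ?L = "4 * side"
  let ?D = "\<lambda>s. explicit_density ?\<zeta> (curve s)"
  obtain d where d: "0 < d" "d \<le> side"
    and right: "\<forall>s\<in>{t0..t0 + d}. ?D s = 0 \<and> curve s = ?\<zeta> + of_real (s - t0) * rdir t0"
    and left: "\<forall>s\<in>{t0 - d..t0}. ?D s = 0 \<and> curve s = ?\<zeta> + of_real (s - t0) * ldir t0"
    using density_near_base_point[of t0] by blast
  let ?a = "t0 + d" and ?b = "t0 + ?L - d"
  have per: "curve s = curve (s - ?L)" for s
    using curve_periodic[of "s - ?L"] by simp
  have a: "1 - curve ?a / ?\<zeta> = of_real d * (- rdir t0 / ?\<zeta>)"
    using bspec[OF right, of ?a] d(1) curve_ne_0[of t0] by (simp add: field_simps)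
  have "curve ?b = ?\<zeta> - of_real d * ldir t0"
    using bspec[OF left, of "t0 - d"] d(1) per[of ?b] by simp
  then have b: "1 - curve ?b / ?\<zeta> = of_real d * (ldir t0 / ?\<zeta>)"
    using curve_ne_0[of t0] by (simp add: field_simps)
  obtain \<alpha> \<beta> where ang: "tangent_angles \<Omega> ?\<zeta> \<alpha> \<beta>"
    using tangent_angles_exist[of t0] by metis
  define H where "H = (\<lambda>s. if s \<in> {?a..?b} then ?D s else 0)"
  have "(?D has_integral (Arg (1 - curve ?b / ?\<zeta>) - Arg (1 - curve ?a / ?\<zeta>)) / pi) {?a..?b}"
    using d(1,2) side_pos by (intro density_has_integral) auto
  then have "(?D has_integral interior_angle \<Omega> ?\<zeta> / pi) {?a..?b}"
    unfolding a b interior_angle_eq[OF ang] Arg_times_of_real[OF d(1)] Arg_turn[OF ang] .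
  then have H: "(H has_integral interior_angle \<Omega> ?\<zeta> / pi) UNIV"
    unfolding H_def by (subst has_integral_restrict_UNIV)
  have [measurable]: "curve \<in> borel_measurable borel"
    by (intro borel_measurable_continuous_onI continuous_on_curve)
  have "integral\<^sup>N lborel H = interior_angle \<Omega> ?\<zeta> / pi"
  proof (rule nn_integral_has_integral_lborel[OF _ _ H])
    show "H \<in> borel_measurable borel" unfolding H_def by measurable
    show "0 \<le> H s" for s
      using explicit_density_nonneg[of ?\<zeta> s] rnorm_curve[of t0] by (simp add: H_def)
  qed
  moreover have "ennreal (?D s) * indicator {t0..<t0 + ?L} s = ennreal (H s)" for s
    using bspec[OF right, of s] bspec[OF left, of "s - ?L"] per[of s] d
    by (auto simp: H_def indicator_def)
  ultimately show ?thesis by simp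
qed

section \<open>The Neumann-Poincare measure as a probability measure\<close>

lemma sets_arclength_measure [simp]: "sets (arclength_measure \<Omega>) = sets (restrict_space borel (frontier \<Omega>))"
  by (simp add: arclength_measure_def)

lemma space_arclength_measure [simp]: "space (arclength_measure \<Omega>) = frontier \<Omega>"
  by (simp add: arclength_measure_def space_restrict_space)

lemma np_density_measurable:
  "(\<lambda>\<sigma>. ennreal (np_density \<Omega> \<zeta> \<sigma>)) \<in> borel_measurable (arclength_measure \<Omega>)"
proof -
  have "(\<lambda>\<sigma>. ennreal (explicit_density \<zeta> \<sigma>)) \<in> borel_measurable (restrict_space borel (frontier \<Omega>))"
    by (intro measurable_restrict_space1) measurable
  then have "(\<lambda>\<sigma>. ennreal (explicit_density \<zeta> \<sigma>)) \<in> borel_measurable (arclength_measure \<Omega>)"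
    by (simp cong: measurable_cong_sets)
  then show ?thesis
    by (rule measurable_cong[THEN iffD2, rotated]) (simp add: np_density_eq)
qed

text \<open>The integral is pulled back to the parameter line, the unknown shift is absorbed by
  translation, and periodicity moves the interval so that it starts at a parameter of
  \<zeta>.\<close>

lemma arclength_integral_density:
  assumes \<zeta>: "\<zeta> \<in> frontier \<Omega>"
  shows "(\<integral>\<^sup>+ \<sigma>. ennreal (np_density \<Omega> \<zeta> \<sigma>) \<partial>arclength_measure \<Omega>) = ennreal (interior_angle \<Omega> \<zeta> / pi)"
proof -
  let ?\<gamma> = "boundary_curve \<Omega>" and ?L = "4 * side"
  obtain c where c: "\<And>t. ?\<gamma> t = curve (t + c)" and par: "is_boundary_param \<Omega> ?L ?\<gamma>"
    and L: "perimeter \<Omega> = ?L"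
    using boundary_curve_eq by metis
  obtain t1 where t1: "t1 \<in> {0..<?L}" "?\<gamma> t1 = \<zeta>"
    using is_boundary_paramD(5)[OF par] \<zeta> by (metis imageE)
  define t0 where "t0 = t1 + c"
  have t0: "curve t0 = \<zeta>" "c \<le> t0" "t0 \<le> c + ?L"
    using t1 c by (auto simp: t0_def)
  have [measurable]: "curve \<in> borel_measurable borel" "?\<gamma> \<in> borel_measurable borel"
    using continuous_on_curve is_boundary_paramD(2)[OF par] by (auto intro: borel_measurable_continuous_onI)
  have meas: "?\<gamma> \<in> measurable (restrict_space lborel {0..<?L}) (restrict_space borel (frontier \<Omega>))"
    using boundary_param_in_frontier[OF par]
    by (intro measurable_restrict_space2 measurable_restrict_space1) auto
  have "(\<integral>\<^sup>+ \<sigma>. ennreal (np_density \<Omega> \<zeta> \<sigma>) \<partial>arclength_measure \<Omega>) =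
      (\<integral>\<^sup>+ t. ennreal (np_density \<Omega> \<zeta> (?\<gamma> t)) \<partial>restrict_space lborel {0..<?L})"
    using np_density_measurable[of \<zeta>] unfolding arclength_measure_def L by (intro nn_integral_distr meas)
  also have "\<dots> = (\<integral>\<^sup>+ t. ennreal (np_density \<Omega> \<zeta> (?\<gamma> t)) * indicator {0..<?L} t \<partial>lborel)"
    by (rule nn_integral_restrict_space) simp
  also have "\<dots> = (\<integral>\<^sup>+ t. ennreal (explicit_density \<zeta> (curve (t + c))) * indicator {0..<?L} t \<partial>lborel)"
    using np_density_eq[OF boundary_param_in_frontier[OF par], of \<zeta>] by (simp add: c)
  also have "\<dots> = (\<integral>\<^sup>+ t. ennreal (explicit_density \<zeta> (curve t)) * indicator {0 + c..<?L + c} t \<partial>lborel)"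
    by (rule nn_integral_shift_indicator[symmetric]) measurable
  also have "\<dots> = (\<integral>\<^sup>+ t. ennreal (explicit_density \<zeta> (curve t)) * indicator {c..<c + ?L} t \<partial>lborel)"
    by (simp add: add.commute)
  also have "\<dots> = (\<integral>\<^sup>+ t. ennreal (explicit_density \<zeta> (curve t)) * indicator {t0..<t0 + ?L} t \<partial>lborel)"
    using t0 by (intro nn_integral_period_cong) (auto simp: curve_periodic)
  also have "\<dots> = ennreal (interior_angle \<Omega> \<zeta> / pi)"
    using density_integral[of t0] by (simp add: t0(1))
  finally show ?thesis .
qed

lemma interior_angle_bounds:
  assumes "\<zeta> \<in> frontier \<Omega>"
  shows "0 < interior_angle \<Omega> \<zeta>" "interior_angle \<Omega> \<zeta> \<le> pi"
proof -
  obtain t where t: "curve t = \<zeta>" using assms curve_surj by (auto simp: frontier_\<Omega>)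
  obtain \<alpha> \<beta> where ang: "tangent_angles \<Omega> (curve t) \<alpha> \<beta>"
    using tangent_angles_exist[of t] by metis
  show "0 < interior_angle \<Omega> \<zeta>" "interior_angle \<Omega> \<zeta> \<le> pi"
    using interior_angle_eq[OF ang] ang unfolding t tangent_angles_def by auto
qed

lemma space_np_measure [simp]: "space (np_measure \<Omega> \<zeta>) = frontier \<Omega>"
proof -
  have "sets (restrict_space borel (frontier \<Omega>)) \<subseteq> Pow (frontier \<Omega>)"
    using sets.space_closed[of "restrict_space borel (frontier \<Omega>)"] by (simp add: space_restrict_space)
  then show ?thesis unfolding np_measure_def by (rule space_measure_of)
qed

lemma sets_np_measure [simp]: "sets (np_measure \<Omega> \<zeta>) = sets (restrict_space borel (frontier \<Omega>))"
proof -
  have "sigma_algebra (frontier \<Omega>) (sets (restrict_space borel (frontier \<Omega>)))"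
    using sets.sigma_algebra_axioms[of "restrict_space borel (frontier \<Omega>)"]
    by (simp add: space_restrict_space)
  then show ?thesis
    unfolding np_measure_def by (rule sigma_algebra.sets_measure_of_eq)
qed

text \<open>The set function given to \<open>measure_of\<close> is recovered only if it is positive
  and countably additive; here it is the sum of a point mass and a density.\<close>

lemma emeasure_np_measure:
  assumes "A \<in> sets (restrict_space borel (frontier \<Omega>))"
  shows "emeasure (np_measure \<Omega> \<zeta>) A =
    ennreal (1 - interior_angle \<Omega> \<zeta> / pi) * indicator A \<zeta> +
    emeasure (density (arclength_measure \<Omega>) (\<lambda>\<sigma>. ennreal (np_density \<Omega> \<zeta> \<sigma>))) A"
  unfolding np_measure_def
proof (rule emeasure_measure_of_sigma)
  let ?M = "restrict_space borel (frontier \<Omega>)"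
  let ?N = "density (arclength_measure \<Omega>) (\<lambda>\<sigma>. ennreal (np_density \<Omega> \<zeta> \<sigma>))"
  let ?k = "ennreal (1 - interior_angle \<Omega> \<zeta> / pi)"
  show "sigma_algebra (frontier \<Omega>) (sets ?M)"
    using sets.sigma_algebra_axioms[of ?M] by (simp add: space_restrict_space)
  show "positive (sets ?M) (\<lambda>A. ?k * indicator A \<zeta> + emeasure ?N A)"
    by (simp add: positive_def)
  show "countably_additive (sets ?M) (\<lambda>A. ?k * indicator A \<zeta> + emeasure ?N A)"
  proof (rule countably_additiveI)
    fix A :: "nat \<Rightarrow> complex set"
    assume A: "range A \<subseteq> sets ?M" "disjoint_family A"
    have "(\<Sum>i. emeasure ?N (A i)) = emeasure ?N (\<Union>i. A i)"
      using A by (intro suminf_emeasure) auto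
    moreover have "(\<Sum>i. ?k * indicator (A i) \<zeta>) = ?k * indicator (\<Union>i. A i) \<zeta>"
      by (simp add: suminf_indicator[OF A(2)])
    ultimately show "(\<Sum>i. ?k * indicator (A i) \<zeta> + emeasure ?N (A i)) =
        ?k * indicator (\<Union>i. A i) \<zeta> + emeasure ?N (\<Union>i. A i)"
      by (simp add: suminf_add[symmetric])
  qed
qed (use assms in auto)

text \<open>The density has mass \<theta> / pi and the atom supplies 1 - \<theta> / pi. The bounds
  on the angle keep both terms nonnegative, so that \<open>ennreal\<close> truncates
  nothing.\<close>

lemma np_measure_total:
  assumes "\<zeta> \<in> frontier \<Omega>"
  shows "emeasure (np_measure \<Omega> \<zeta>) (frontier \<Omega>) = 1"
proof -
  let ?M = "restrict_space borel (frontier \<Omega>)"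
  let ?N = "density (arclength_measure \<Omega>) (\<lambda>\<sigma>. ennreal (np_density \<Omega> \<zeta> \<sigma>))"
  have top: "frontier \<Omega> \<in> sets ?M"
    using sets.top[of ?M] by (simp add: space_restrict_space)
  have "emeasure ?N (frontier \<Omega>) = (\<integral>\<^sup>+ \<sigma>. ennreal (np_density \<Omega> \<zeta> \<sigma>) * indicator (frontier \<Omega>) \<sigma> \<partial>arclength_measure \<Omega>)"
    by (rule emeasure_density[OF np_density_measurable]) (simp add: top)
  also have "\<dots> = (\<integral>\<^sup>+ \<sigma>. ennreal (np_density \<Omega> \<zeta> \<sigma>) \<partial>arclength_measure \<Omega>)"
    by (intro nn_integral_cong) simp
  also have "\<dots> = ennreal (interior_angle \<Omega> \<zeta> / pi)"
    by (rule arclength_integral_density[OF assms])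
  finally have "emeasure (np_measure \<Omega> \<zeta>) (frontier \<Omega>) =
      ennreal (1 - interior_angle \<Omega> \<zeta> / pi) + ennreal (interior_angle \<Omega> \<zeta> / pi)"
    using assms by (simp add: emeasure_np_measure[OF top])
  also have "\<dots> = ennreal (1 - interior_angle \<Omega> \<zeta> / pi + interior_angle \<Omega> \<zeta> / pi)"
    using interior_angle_bounds[OF assms] by (intro ennreal_plus[symmetric]) auto
  finally show ?thesis by simp
qed

lemma np_measure_atom:
  assumes "\<zeta> \<in> frontier \<Omega>"
  shows "1 - interior_angle \<Omega> \<zeta> / pi \<le> measure (np_measure \<Omega> \<zeta>) {\<zeta>}"
proof -
  have "{\<zeta>} \<in> sets (restrict_space borel (frontier \<Omega>))"
    using assms by (auto simp: sets_restrict_space image_iff intro!: bexI[of _ "{\<zeta>}"])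
  then have "ennreal (1 - interior_angle \<Omega> \<zeta> / pi) \<le> emeasure (np_measure \<Omega> \<zeta>) {\<zeta>}"
    by (simp add: emeasure_np_measure)
  moreover have "finite_measure (np_measure \<Omega> \<zeta>)"
    by (rule finite_measureI) (simp add: np_measure_total[OF assms])
  ultimately show ?thesis
    by (simp add: finite_measure.emeasure_eq_measure)
qed

end

section \<open>The lower bound\<close>

lemma norm_SUP_bounds:
  fixes g :: "'a \<Rightarrow> complex"
  assumes "bounded (g ` X)"
  shows "bdd_above ((\<lambda>\<zeta>. cmod (g \<zeta> - c)) ` X)"
    and "X \<noteq> {} \<Longrightarrow> 0 \<le> (SUP \<zeta>\<in>X. cmod (g \<zeta> - c))"
proof -
  obtain B where B: "\<And>\<zeta>. \<zeta> \<in> X \<Longrightarrow> cmod (g \<zeta>) \<le> B"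
    using assms by (auto simp: bounded_iff)
  show bdd: "bdd_above ((\<lambda>\<zeta>. cmod (g \<zeta> - c)) ` X)"
  proof (rule bdd_aboveI2)
    show "cmod (g \<zeta> - c) \<le> B + cmod c" if "\<zeta> \<in> X" for \<zeta>
      using norm_triangle_ineq4[of "g \<zeta>" c] B[OF that] by linarith
  qed
  assume "X \<noteq> {}"
  then obtain \<zeta> where "\<zeta> \<in> X" by blast
  then show "0 \<le> (SUP \<zeta>\<in>X. cmod (g \<zeta> - c))"
    by (intro cSUP_upper2[OF bdd, of \<zeta>]) simp_all
qed

lemma quotient_norm_bdd_below:
  fixes g :: "complex \<Rightarrow> complex"
  assumes "X \<noteq> {}" "bounded (g ` X)"
  shows "bdd_below (range (\<lambda>c. SUP \<zeta>\<in>X. cmod (g \<zeta> - c)))"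
  using norm_SUP_bounds(2)[OF assms(2,1)] by (rule bdd_belowI2)

lemma quotient_norm_le:
  assumes "X \<noteq> {}" "\<And>\<zeta>. \<zeta> \<in> X \<Longrightarrow> cmod (g \<zeta> - c) \<le> r"
  shows "quotient_norm X g \<le> r"
proof -
  have "cmod (g \<zeta>) \<le> r + cmod c" if "\<zeta> \<in> X" for \<zeta>
    using assms(2)[OF that] norm_triangle_sub[of "g \<zeta>" c] by linarith
  then have "bounded (g ` X)" by (auto simp: bounded_iff)
  then have "quotient_norm X g \<le> (SUP \<zeta>\<in>X. cmod (g \<zeta> - c))"
    unfolding quotient_norm_def by (intro cINF_lower quotient_norm_bdd_below assms(1)) auto
  also have "\<dots> \<le> r"
    using assms by (rule cSUP_least)
  finally show ?thesis .
qed

text \<open>For every centre c, the triangle inequality bounds the distance of the two values by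
  twice the supremum.\<close>

lemma quotient_norm_ge:
  assumes "bounded (g ` X)" "x \<in> X" "y \<in> X" "2 * r \<le> cmod (g x - g y)"
  shows "r \<le> quotient_norm X g"
  unfolding quotient_norm_def
proof (rule cINF_greatest)
  fix c
  have "cmod (g \<zeta> - c) \<le> (SUP \<zeta>\<in>X. cmod (g \<zeta> - c))" if "\<zeta> \<in> X" for \<zeta>
    using that norm_SUP_bounds(1)[OF assms(1)] by (rule cSUP_upper)
  from this[OF assms(2)] this[OF assms(3)]
  show "r \<le> (SUP \<zeta>\<in>X. cmod (g \<zeta> - c))"
    using assms(4) norm_triangle_ineq4[of "g x - c" "g y - c"] by simp
qed simp

text \<open>Strict inequality yields a centre directly, without showing that the infimum is
  attained.\<close>

lemma quotient_norm_lessD: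
  assumes "X \<noteq> {}" "bounded (g ` X)" "quotient_norm X g < r"
  obtains c where "\<And>\<zeta>. \<zeta> \<in> X \<Longrightarrow> cmod (g \<zeta> - c) \<le> r"
proof -
  obtain c where c: "(SUP \<zeta>\<in>X. cmod (g \<zeta> - c)) < r"
    using assms(3) unfolding quotient_norm_def
    by (subst (asm) cINF_less_iff) (auto intro: quotient_norm_bdd_below[OF assms(1,2)])
  have "cmod (g \<zeta> - c) \<le> r" if "\<zeta> \<in> X" for \<zeta>
    using cSUP_upper[OF that norm_SUP_bounds(1)[OF assms(2)], of c] c by linarith
  then show ?thesis using that by blast
qed

context rhombus
begin

section \<open>The Neumann-Poincare operator and finiteness of the configuration constant\<close>

lemma finite_np_measure:
  assumes "\<zeta> \<in> frontier \<Omega>"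
  shows "finite_measure (np_measure \<Omega> \<zeta>)" "measure (np_measure \<Omega> \<zeta>) (frontier \<Omega>) = 1"
  using np_measure_total[OF assms] by (auto intro!: finite_measureI simp: measure_def)

lemma bounded_on_frontier:
  fixes f :: "complex \<Rightarrow> 'a :: metric_space"
  assumes "continuous_on (frontier \<Omega>) f"
  shows "bounded (f ` frontier \<Omega>)"
  using compact_continuous_image[OF assms compact_frontier[OF compact_\<Omega>]] by (rule compact_imp_bounded)

lemma np_integrable:
  fixes f :: "complex \<Rightarrow> 'a :: {banach, second_countable_topology}"
  assumes "\<zeta> \<in> frontier \<Omega>" "continuous_on (frontier \<Omega>) f"
  shows "integrable (np_measure \<Omega> \<zeta>) f"
proof -
  obtain B where "\<forall>x\<in>f ` frontier \<Omega>. norm x \<le> B"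
    using bounded_on_frontier[OF assms(2)] by (auto simp: bounded_iff)
  moreover have "f \<in> borel_measurable (np_measure \<Omega> \<zeta>)"
    using borel_measurable_continuous_on_restrict[OF assms(2)] by (simp cong: measurable_cong_sets)
  ultimately show ?thesis
    by (intro finite_measure.integrable_const_bound[OF finite_np_measure(1)[OF assms(1)], of _ B]) auto
qed

text \<open>Averaging against a probability measure fixes the constant c, so the difference is the
  average of f - c.\<close>

lemma neumann_poincare_norm_le:
  assumes \<zeta>: "\<zeta> \<in> frontier \<Omega>" and f: "continuous_on (frontier \<Omega>) f"
    and B: "\<And>\<sigma>. \<sigma> \<in> frontier \<Omega> \<Longrightarrow> cmod (f \<sigma> - c) \<le> B"
  shows "cmod (neumann_poincare \<Omega> f \<zeta> - c) \<le> B"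
proof -
  let ?\<mu> = "np_measure \<Omega> \<zeta>"
  have cont: "continuous_on (frontier \<Omega>) (\<lambda>\<sigma>. cmod (f \<sigma> - c))"
    by (intro continuous_intros f)
  have "(LINT \<sigma>|?\<mu>. f \<sigma> - c) = neumann_poincare \<Omega> f \<zeta> - c"
    unfolding neumann_poincare_def
    using np_integrable[OF \<zeta> f] np_integrable[OF \<zeta> continuous_on_const[of _ c]] finite_np_measure(2)[OF \<zeta>]
    by simp
  then have "cmod (neumann_poincare \<Omega> f \<zeta> - c) \<le> (LINT \<sigma>|?\<mu>. cmod (f \<sigma> - c))"
    using integral_norm_bound[of ?\<mu> "\<lambda>\<sigma>. f \<sigma> - c"] by simp
  also have "\<dots> \<le> (LINT \<sigma>|?\<mu>. B)"
    using B by (intro integral_mono np_integrable[OF \<zeta>] cont continuous_on_const) auto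
  also have "\<dots> = B"
    using finite_np_measure(2)[OF \<zeta>] by simp
  finally show ?thesis .
qed

lemma frontier_nonempty: "frontier \<Omega> \<noteq> {}"
  using rnorm_curve by (auto simp: frontier_\<Omega>)

lemma analytic_continuous_on_frontier:
  assumes "f \<in> analytic_algebra \<Omega>"
  shows "continuous_on (frontier \<Omega>) f"
  using assms frontier_subset_closed[OF closed_\<Omega>]
  by (auto simp: analytic_algebra_def intro: continuous_on_subset)

lemma quotient_norm_le_config_const:
  assumes "f \<in> analytic_algebra \<Omega>" "quotient_norm (frontier \<Omega>) f \<le> 1"
  shows "quotient_norm (frontier \<Omega>) (neumann_poincare \<Omega> f) \<le> analytic_config_const \<Omega>"
  unfolding analytic_config_const_def
proof (rule cSUP_upper)
  show "bdd_above ((\<lambda>f. quotient_norm (frontier \<Omega>) (neumann_poincare \<Omega> f)) `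
      {f \<in> analytic_algebra \<Omega>. quotient_norm (frontier \<Omega>) f \<le> 1})"
  proof (rule bdd_aboveI2, clarify)
    fix f assume f: "f \<in> analytic_algebra \<Omega>" "quotient_norm (frontier \<Omega>) f \<le> 1"
    note cont = analytic_continuous_on_frontier[OF f(1)]
    \<comment> \<open>Relaxing 1 to 2 provides the strict inequality for
      \<open>quotient_norm_lessD\<close>; any uniform bound makes the supremum meaningful.\<close>
    have "quotient_norm (frontier \<Omega>) f < 2" using f(2) by simp
    then obtain c where c: "\<And>\<sigma>. \<sigma> \<in> frontier \<Omega> \<Longrightarrow> cmod (f \<sigma> - c) \<le> 2"
      using quotient_norm_lessD[OF frontier_nonempty bounded_on_frontier[OF cont]] by metis
    show "quotient_norm (frontier \<Omega>) (neumann_poincare \<Omega> f) \<le> 2"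
      using neumann_poincare_norm_le[OF _ cont c] frontier_nonempty by (intro quotient_norm_le) auto
  qed
qed (use assms in auto)

section \<open>The two tips and the test function\<close>

lemma curve_at_vertex: "curve (side * of_int n) = vertex n"
  using curve_on_side[of n "side * of_int n"] side_pos by simp

lemma directions_at_vertex: "rdir (side * of_int n) = dir n" "ldir (side * of_int n) = dir (n - 1)"
  using side_pos by (simp_all add: rdir_def ldir_def)

lemma cis_arctan: "cis (arctan \<epsilon>) = (1 + of_real \<epsilon> * \<i>) / of_real side"
  by (simp add: complex_eq_iff cos_arctan sin_arctan side_def)

lemma interior_angle_at_tips:
  assumes "z \<in> {1, - 1}"
  shows "z \<in> frontier \<Omega>" "interior_angle \<Omega> z \<le> 2 * \<epsilon>"
proof -
  show "z \<in> frontier \<Omega>" using assms by (auto simp: frontier_\<Omega> rnorm_def)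
  have v: "vertex (-1) = - (of_real \<epsilon> * \<i>)" "vertex 0 = 1" "vertex 1 = of_real \<epsilon> * \<i>"
    "vertex 2 = -1" "vertex 3 = - (of_real \<epsilon> * \<i>)"
    by (auto simp: vertex_def stretch_def complex_eq_iff power3_eq_cube power_int_minus)
  have at: "0 < arctan \<epsilon>" "arctan \<epsilon> < pi / 2" "arctan \<epsilon> \<le> \<epsilon>"
    using \<epsilon>_pos arctan_ubound[of \<epsilon>] arctan_le_self[of \<epsilon>] by auto
  have cis: "cis (pi - arctan \<epsilon>) = (- 1 + of_real \<epsilon> * \<i>) / of_real side"
    "cis (arctan \<epsilon> - pi) = (- 1 - of_real \<epsilon> * \<i>) / of_real side"
    "cis (- arctan \<epsilon>) = (1 - of_real \<epsilon> * \<i>) / of_real side"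
    by (simp_all add: complex_eq_iff cos_arctan sin_arctan side_def)
  \<comment> \<open>At the tip 1 the sides have angles arctan \<epsilon> and pi - arctan \<epsilon>;
    at -1 both are turned back by pi. Either way the interior angle is 2 arctan \<epsilon>.\<close>
  have t1: "tangent_angles \<Omega> (curve (side * of_int 0)) (arctan \<epsilon>) (pi - arctan \<epsilon>)"
    unfolding tangent_angles_iff directions_at_vertex cis cis_arctan
    using at v by (simp add: dir_def)
  have t2: "tangent_angles \<Omega> (curve (side * of_int 2)) (arctan \<epsilon> - pi) (- arctan \<epsilon>)"
    unfolding tangent_angles_iff directions_at_vertex cis
    using at v by (simp add: dir_def)
  show "interior_angle \<Omega> z \<le> 2 * \<epsilon>"
    using assms interior_angle_eq[OF t1] interior_angle_eq[OF t2] at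
    unfolding curve_at_vertex v by auto
qed

text \<open>The factor z treats both tips alike: Re (z \<sigma>) is at least -1 on the boundary and
  equals 1 at \<sigma> = z, hence dominates -1 plus twice the indicator of z. Integration leaves
  only the mass of the atom to estimate.\<close>

lemma neumann_poincare_id_at_tips:
  assumes z: "z \<in> {1, - 1}"
  shows "1 - 4 / pi * \<epsilon> \<le> Re (z * neumann_poincare \<Omega> (\<lambda>\<sigma>. \<sigma>) z)"
proof -
  let ?\<mu> = "np_measure \<Omega> z"
  note fr = interior_angle_at_tips(1)[OF z]
  interpret finite_measure ?\<mu> by (rule finite_np_measure(1)[OF fr])
  have int: "integrable ?\<mu> (\<lambda>\<sigma>. \<sigma>)"
    using fr by (rule np_integrable) (rule continuous_on_id)
  have "{z} \<in> sets (restrict_space borel (frontier \<Omega>))"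
    using fr by (auto simp: sets_restrict_space image_iff intro!: bexI[of _ "{z}"])
  then have atom: "{z} \<in> sets ?\<mu>" by simp
  have ind: "integrable ?\<mu> (indicat_real {z})"
    by (rule integrable_real_indicator[OF atom]) (simp add: emeasure_eq_measure)
  have "4 / pi * \<epsilon> \<ge> 2 * (interior_angle \<Omega> z / pi)"
    using interior_angle_at_tips(2)[OF z] by (simp add: field_simps)
  then have "1 - 4 / pi * \<epsilon> \<le> - 1 + 2 * measure ?\<mu> {z}"
    using np_measure_atom[OF fr] by linarith
  also have "\<dots> = (LINT \<sigma>|?\<mu>. - 1 + 2 * indicat_real {z} \<sigma>)"
  proof -
    have "(LINT \<sigma>|?\<mu>. - 1 + 2 * indicat_real {z} \<sigma>) = (LINT \<sigma>|?\<mu>. - 1) + (LINT \<sigma>|?\<mu>. 2 * indicat_real {z} \<sigma>)"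
      by (rule Bochner_Integration.integral_add) (use ind in auto)
    then show ?thesis using finite_np_measure(2)[OF fr] fr by simp
  qed
  also have "\<dots> \<le> (LINT \<sigma>|?\<mu>. Re (z * \<sigma>))"
  proof (rule integral_mono)
    show "integrable ?\<mu> (\<lambda>\<sigma>. - 1 + 2 * indicat_real {z} \<sigma>)"
      using ind by simp
    show "integrable ?\<mu> (\<lambda>\<sigma>. Re (z * \<sigma>))"
      using int by simp
    fix \<sigma> assume "\<sigma> \<in> space ?\<mu>"
    then have "\<bar>Re \<sigma>\<bar> + \<bar>Im \<sigma>\<bar> / \<epsilon> = 1" by (simp add: frontier_\<Omega> rnorm_def)
    moreover have "0 \<le> \<bar>Im \<sigma>\<bar> / \<epsilon>" using \<epsilon>_pos by simp
    ultimately have "\<bar>Re \<sigma>\<bar> \<le> 1" by linarith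
    then show "- 1 + 2 * indicat_real {z} \<sigma> \<le> Re (z * \<sigma>)"
      using z by (auto simp: indicator_def)
  qed
  also have "\<dots> = Re (z * neumann_poincare \<Omega> (\<lambda>\<sigma>. \<sigma>) z)"
    using int by (simp add: neumann_poincare_def)
  finally show ?thesis .
qed

lemma config_const_ge: "1 - 4 / pi * \<epsilon> \<le> analytic_config_const \<Omega>"
proof (cases "\<epsilon> \<le> 1")
  case True
  let ?f = "\<lambda>\<sigma> :: complex. \<sigma>"
  have f: "?f \<in> analytic_algebra \<Omega>"
    by (simp add: analytic_algebra_def)
  have bound: "cmod \<sigma> \<le> 1" if "\<sigma> \<in> frontier \<Omega>" for \<sigma>
  proof -
    have "\<bar>Im \<sigma>\<bar> \<le> \<bar>Im \<sigma>\<bar> / \<epsilon>"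
      using True \<epsilon>_pos by (simp add: pos_le_divide_eq mult_left_le)
    then show ?thesis
      using that cmod_le[of \<sigma>] by (simp add: frontier_\<Omega> rnorm_def)
  qed
  let ?g = "neumann_poincare \<Omega> ?f"
  have "cmod (?g \<zeta>) \<le> 1" if "\<zeta> \<in> frontier \<Omega>" for \<zeta>
    using neumann_poincare_norm_le[OF that continuous_on_id, of 0 1] bound by simp
  then have "bounded (?g ` frontier \<Omega>)" by (auto simp: bounded_iff)
  \<comment> \<open>The real part of g(1) - g(-1) is the sum of the two quantities estimated at the
    tips.\<close>
  moreover have "2 * (1 - 4 / pi * \<epsilon>) \<le> cmod (?g 1 - ?g (- 1))"
    using neumann_poincare_id_at_tips[of 1] neumann_poincare_id_at_tips[of "- 1"]
      complex_Re_le_cmod[of "?g 1 - ?g (- 1)"] by simp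
  ultimately have "1 - 4 / pi * \<epsilon> \<le> quotient_norm (frontier \<Omega>) ?g"
    using interior_angle_at_tips(1) by (intro quotient_norm_ge[of _ _ 1 "- 1"]) auto
  also have "quotient_norm (frontier \<Omega>) ?f \<le> 1"
    using bound frontier_nonempty by (intro quotient_norm_le[of _ _ 0]) auto
  then have "quotient_norm (frontier \<Omega>) ?g \<le> analytic_config_const \<Omega>"
    by (rule quotient_norm_le_config_const[OF f])
  finally show ?thesis .
next
  case False
  \<comment> \<open>As pi < 4 and \<epsilon> > 1, the claimed bound is not positive, and it remains
    to see that the constant is nonnegative.\<close>
  have "1 \<le> 4 / pi" using pi_less_4 by simp
  then have "1 * 1 \<le> 4 / pi * \<epsilon>" using False by (intro mult_mono) auto
  moreover have "neumann_poincare \<Omega> (\<lambda>_. 0) = (\<lambda>_. 0)"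
    by (simp add: neumann_poincare_def fun_eq_iff)
  then have "0 \<le> quotient_norm (frontier \<Omega>) (neumann_poincare \<Omega> (\<lambda>_. 0))"
    using interior_angle_at_tips(1)[of 1] by (intro quotient_norm_ge[of _ _ 1 1]) (auto simp: image_constant_conv)
  moreover have "quotient_norm (frontier \<Omega>) (neumann_poincare \<Omega> (\<lambda>_. 0)) \<le> analytic_config_const \<Omega>"
    using frontier_nonempty
    by (intro quotient_norm_le_config_const quotient_norm_le[of _ _ 0]) (auto simp: analytic_algebra_def)
  ultimately show ?thesis by linarith
qed

end

theorem proposition26:
  fixes \<epsilon> :: real
  assumes "\<epsilon> > 0"
  shows "analytic_config_const (convex hull {1, - 1, of_real \<epsilon> * \<i>, - (of_real \<epsilon> * \<i>)})
           \<ge> 1 - 4 / pi * \<epsilon>"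
proof -
  interpret rhombus \<epsilon> using assms by unfold_locales
  show ?thesis using config_const_ge unfolding \<Omega>_def .
qed

end
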